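(* Let $d=2$. Fix $\kappa\ge4$ an even integer, and fix an odd integer $j$ with $1\le j\le\lfloor\kappa/2\rfloor$. There is a sequence $\{\mathcal{E}_n\}_{n=1}^\infty$, which depends on $\kappa$, such that $\{\mathcal{E}_n\}\subset\big(\cos^2(j\pi/\kappa),\ \cos((j-1)\pi/\kappa)\cos(j\pi/\kappa)\big)\cap\boldsymbol{\Theta}_\kappa(D)$ and $\mathcal{E}_{n+2}<\mathcal{E}_{n+1}<\mathcal{E}_n$ for all $n\ge1$. Also $\mathcal{E}_{2n-1},\mathcal{E}_{2n}\in\boldsymbol{\Theta}_{n,\kappa}(D)$ for all $n\ge1$, and for each $n\ge1$ there are real numbers $X_0,\ldots,X_{n+1}$ solving, with $\mathcal{E}_n$, the system $(\Sigma_n)$ of the context and satisfying $$\mathcal{E}_n/\cos((j-1)\pi/\kappa)=X_0<X_1<\cdots<X_n<X_{n+1}:=\cos((j-1)\pi/\kappa).$$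
   Context: Operators. For $d \geq 1$ let $\mathscr{H}=\ell^2(\mathbb{Z}^d)$, let $S_i$ be the shift $(S_i^{\pm 1} u)(n) = u(n_1,\ldots,n_i \mp 1,\ldots,n_d)$, $\Delta_i = \frac12 (S_i + S_i^* )$ and $D=D[d] = \prod_{i=1}^d \Delta_i$ (Molchanov--Vainberg Laplacian); $\sigma(D)=[-1,1]$. Let $(N_i u)(n) = n_i u(n)$. For $p,\kappa \in \mathbb{N}^*=\{1,2,\ldots\}$ let $A_i(p,\kappa)$ be the closure of $\frac{1}{4\mathrm{i}}\left[(S_i^{p\kappa}-S_i^{-p\kappa})N_i + N_i (S_i^{p\kappa}-S_i^{-p\kappa})\right]$ defined on compactly supported sequences, and $A_{p\kappa} = \sum_{i=1}^d A_i(p,\kappa)$ (self-adjoint). Thresholds. $\boldsymbol{\mu}_\kappa(D)$ is the set of $E \in \sigma(D)$ for which there exist a self-adjoint linear combination (finite or infinite) $\mathbb{A} = \sum_{p \geq 1} \rho_{p\kappa} A_{p\kappa}$, $\rho_{p\kappa}\in\mathbb{R}$, an interval $I \ni E$ and $\gamma>0$ with $1_I(D)[D,\mathrm{i}\mathbb{A}]_\circ 1_I(D) \geq \gamma 1_I(D)$, where $1_I(D)$ is the spectral projection of $D$ on $I$ and $[D,\mathrm{i}\mathbb{A}]_\circ$ is the bounded extension of the commutator from compactly supported sequences. $\boldsymbol{\Theta}_\kappa(D) = \sigma(D)\setminus \boldsymbol{\mu}_\kappa(D)$. Let $T_n,U_n$ be the Chebyshev polynomials of the first and second kind, $T_n(\cos\theta)=\cos(n\theta)$,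 $U_{n-1}(\cos\theta)=\sin(n\theta)/\sin\theta$. For $\vec{x}\in[-1,1]^d$ let $g_{p\kappa}(\vec{x}) = \sum_{i=1}^d \big(\prod_{l \neq i} x_l\big)(1-x_i^2)U_{p\kappa-1}(x_i)$, and $S_E = \{\vec{x}\in[-1,1]^d : \prod_{l=1}^d x_l = E\}$. The function $G_\kappa = \sum_p \rho_{p\kappa} g_{p\kappa}$ represents $[D,\mathrm{i}\mathbb{A}]_\circ$ by functional calculus (with $\Delta_i \leftrightarrow x_i$), and by continuity of $G_\kappa$, $E\in\boldsymbol{\mu}_\kappa(D)$ iff $G_\kappa>0$ on $S_E$ for some such $\mathbb{A}$. For $m\in\mathbb{N}^*$, $\boldsymbol{\Theta}_{m,\kappa}(D)$ is the set of $E\in[-1,1]$ such that there are $\vec{x}_0,\ldots,\vec{x}_m \in S_E$ and real numbers $\omega_0,\ldots,\omega_{m-1}\leq 0$ with $g_{p\kappa}(\vec{x}_m) = \sum_{q=0}^{m-1}\omega_q\, g_{p\kappa}(\vec{x}_q)$ for all $p\in\mathbb{N}^*$. System $(\Sigma_n)$ in the unknowns $\mathcal{E}_n,X_0,\ldots,X_{n+1}$: if $n$ is odd, $T_\kappa(X_q)=T_\kappa(X_{n-q})$ for $0\le q\le(n-1)/2$ and $X_{n-q}=\mathcal{E}_n/X_{1+q}$ for $-1\le q\le(n-1)/2$; if $n$ is even, $T_\kappa(X_q)=T_\kappa(X_{n-q})$ for $0\le q\le n/2-1$ and $X_{n-q}=\mathcal{E}_n/X_{1+q}$ for $-1\le q\le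 n/2-1$.
   Formalization: The case j = κ/2 (possible only when κ/2 is odd, e.g. κ = 6, j = 3) is excluded: there cos(jπ/κ) = 0, so the interval for the energies is (0,0), which is empty, and the claim as stated is false. *)

theory Defs
  imports "HOL-Analysis.Analysis"
begin

section \<open>The Hilbert space of square-summable sequences on the lattice\<close>

typedef (overloaded) 'd ell2 =
  "{u :: int ^ 'd::finite \<Rightarrow> complex. (\<lambda>n. (cmod (u n))\<^sup>2) summable_on UNIV}"
  morphisms seq Abs_ell2
  by (rule exI[of _ "\<lambda>_. 0"]) simp

setup_lifting type_definition_ell2

lemma seq_summable: "(\<lambda>n. (cmod (seq u n))\<^sup>2) summable_on UNIV"
  using seq[of u] by simp

lemma ell2_eqI: "(\<And>n. seq u n = seq v n) \<Longrightarrow> u = v"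
  by (metis seq_inject ext)

lemma square_summable_add:
  fixes f g :: "'x \<Rightarrow> complex"
  assumes "(\<lambda>n. (cmod (f n))\<^sup>2) summable_on UNIV" "(\<lambda>n. (cmod (g n))\<^sup>2) summable_on UNIV"
  shows "(\<lambda>n. (cmod (f n + g n))\<^sup>2) summable_on UNIV"
proof (rule summable_on_comparison_test)
  show "(\<lambda>n. 2 * (cmod (f n))\<^sup>2 + 2 * (cmod (g n))\<^sup>2) summable_on UNIV"
    by (intro summable_on_add summable_on_cmult_right assms)
  fix n
  have "(cmod (f n + g n))\<^sup>2 \<le> (cmod (f n) + cmod (g n))\<^sup>2"
    by (intro power_mono norm_triangle_ineq) simp
  also have "\<dots> \<le> 2 * (cmod (f n))\<^sup>2 + 2 * (cmod (g n))\<^sup>2"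
    using sum_squares_bound[of "cmod (f n)" "cmod (g n)"] by (simp add: power2_sum)
  finally show "(cmod (f n + g n))\<^sup>2 \<le> 2 * (cmod (f n))\<^sup>2 + 2 * (cmod (g n))\<^sup>2" .
qed simp

lemma square_summable_scale:
  fixes f :: "'x \<Rightarrow> complex"
  assumes "(\<lambda>n. (cmod (f n))\<^sup>2) summable_on UNIV"
  shows "(\<lambda>n. (cmod (c * f n))\<^sup>2) summable_on UNIV"
  using summable_on_cmult_right[OF assms, of "(cmod c)\<^sup>2"]
  by (simp add: norm_mult power_mult_distrib)

lemma cinner_summable:
  "(\<lambda>n. cnj (seq u n) * seq v n) summable_on UNIV"
proof (rule abs_summable_summable, rule summable_on_comparison_test)
  show "(\<lambda>n. (cmod (seq u n))\<^sup>2 + (cmod (seq v n))\<^sup>2) summable_on UNIV"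
    by (intro summable_on_add seq_summable)
  fix n
  show "norm (cnj (seq u n) * seq v n) \<le> (cmod (seq u n))\<^sup>2 + (cmod (seq v n))\<^sup>2"
    using sum_squares_bound[of "cmod (seq u n)" "cmod (seq v n)"]
      mult_nonneg_nonneg[OF norm_ge_zero[of "seq u n"] norm_ge_zero[of "seq v n"]]
    unfolding norm_mult complex_mod_cnj by linarith
qed simp

definition cinner :: "'d::finite ell2 \<Rightarrow> 'd ell2 \<Rightarrow> complex" where
  "cinner u v = (\<Sum>\<^sub>\<infinity>n. cnj (seq u n) * seq v n)"

instantiation ell2 :: (finite) real_vector
begin

lift_definition zero_ell2 :: "'a ell2" is "\<lambda>_. 0" by simp

lift_definition plus_ell2 :: "'a ell2 \<Rightarrow> 'a ell2 \<Rightarrow> 'a ell2" is "\<lambda>u v n. u n + v n"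
  by (rule square_summable_add)

lift_definition uminus_ell2 :: "'a ell2 \<Rightarrow> 'a ell2" is "\<lambda>u n. - u n" by simp

lift_definition minus_ell2 :: "'a ell2 \<Rightarrow> 'a ell2 \<Rightarrow> 'a ell2" is "\<lambda>u v n. u n - v n"
  subgoal for u v using square_summable_add[of u "\<lambda>n. - v n"] by simp
  done

lift_definition scaleR_ell2 :: "real \<Rightarrow> 'a ell2 \<Rightarrow> 'a ell2" is "\<lambda>r u n. complex_of_real r * u n"
  by (rule square_summable_scale)

instance
  by intro_classes (transfer; simp add: algebra_simps fun_eq_iff)+

end

text \<open>The real inner product is the real part of the complex one, so that the norm and the
  topology are the usual ones of the complex Hilbert space.\<close>

instantiation ell2 :: (finite) real_inner
begin

definition inner_ell2 :: "'a ell2 \<Rightarrow> 'a ell2 \<Rightarrow> real" where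
  "inner_ell2 u v = Re (cinner u v)"

definition norm_ell2 :: "'a ell2 \<Rightarrow> real" where
  "norm_ell2 u = sqrt (inner u u)"

definition sgn_ell2 :: "'a ell2 \<Rightarrow> 'a ell2" where
  "sgn_ell2 u = u /\<^sub>R norm u"

definition dist_ell2 :: "'a ell2 \<Rightarrow> 'a ell2 \<Rightarrow> real" where
  "dist_ell2 u v = norm (u - v)"

definition uniformity_ell2 :: "('a ell2 \<times> 'a ell2) filter" where
  "uniformity_ell2 = (INF e\<in>{0 <..}. principal {(x, y). dist x y < e})"

definition open_ell2 :: "'a ell2 set \<Rightarrow> bool" where
  "open_ell2 U \<longleftrightarrow> (\<forall>x\<in>U. eventually (\<lambda>(x', y). x' = x \<longrightarrow> y \<in> U) uniformity)"

instance
proof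
  fix x y z :: "'a ell2" and r :: real
  have self: "inner x x = (\<Sum>\<^sub>\<infinity>n. (cmod (seq x n))\<^sup>2)" for x :: "'a ell2"
    unfolding inner_ell2_def cinner_def
    by (subst infsum_Re[OF cinner_summable, symmetric]) (simp add: cmod_power2, simp add: power2_eq_square)
  have "cinner y x = cnj (cinner x y)"
    unfolding cinner_def by (subst infsum_cnj[symmetric]) (simp add: mult.commute)
  then show "inner x y = inner y x" by (simp add: inner_ell2_def)
  have "cinner (x + y) z = cinner x z + cinner y z"
    unfolding cinner_def
    by (subst infsum_add[symmetric]) (simp_all add: cinner_summable plus_ell2.rep_eq distrib_right)
  then show "inner (x + y) z = inner x z + inner y z" by (simp add: inner_ell2_def)
  have "cinner (r *\<^sub>R x) z = of_real r * cinner x z" for z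
    unfolding cinner_def
    by (subst infsum_cmult_right[symmetric]) (simp_all add: cinner_summable scaleR_ell2.rep_eq mult.assoc)
  then show "inner (r *\<^sub>R x) y = r * inner x y" by (simp add: inner_ell2_def)
  show "0 \<le> inner x x" unfolding self by (rule infsum_nonneg) simp
  show "(inner x x = 0) = (x = 0)"
  proof
    assume "inner x x = 0"
    then have "(cmod (seq x n))\<^sup>2 = 0" for n
      unfolding self by (intro nonneg_infsum_le_0D[where A = UNIV]) (auto simp: seq_summable)
    then show "x = 0" by (intro ell2_eqI) (simp add: zero_ell2.rep_eq)
  qed (simp add: self zero_ell2.rep_eq)
qed (fact norm_ell2_def sgn_ell2_def dist_ell2_def uniformity_ell2_def open_ell2_def)+

end

lift_definition scaleC :: "complex \<Rightarrow> 'd::finite ell2 \<Rightarrow> 'd ell2" is "\<lambda>c u n. c * u n"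
  by (rule square_summable_scale)

definition fin_supp :: "'d::finite ell2 \<Rightarrow> bool" where
  "fin_supp u \<longleftrightarrow> finite {n. seq u n \<noteq> 0}"

section \<open>Operators on a complex Hilbert space\<close>

definition bounded_clinear :: "('d::finite ell2 \<Rightarrow> 'd ell2) \<Rightarrow> bool" where
  "bounded_clinear T \<longleftrightarrow> bounded_linear T \<and> (\<forall>c u. T (scaleC c u) = scaleC c (T u))"

definition spectrum :: "('d::finite ell2 \<Rightarrow> 'd ell2) \<Rightarrow> complex set" where
  "spectrum T = {z. \<not> (\<exists>R. bounded_clinear R \<and>
     (\<forall>u. R (T u - scaleC z u) = u) \<and> (\<forall>u. T (R u) - scaleC z (R u) = u))}"

definition orth_projection :: "('d::finite ell2 \<Rightarrow> 'd ell2) \<Rightarrow> bool" where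
  "orth_projection P \<longleftrightarrow> bounded_clinear P \<and> (\<forall>u. P (P u) = P u) \<and>
     (\<forall>u v. cinner (P u) v = cinner u (P v))"

text \<open>\<open>E\<close> is the (compactly supported) projection-valued measure on the Borel sets of the line
  with \<open>T = \<integral>\<lambda> dE(\<lambda>)\<close>, the integral being taken in the quadratic form sense. For a bounded
  self-adjoint \<open>T\<close> it exists and is unique on Borel sets by the spectral theorem, so that
  \<open>spectral_projection T I P\<close> says \<open>P = 1\<^sub>I(T)\<close>.\<close>

definition spectral_measure ::
    "('d::finite ell2 \<Rightarrow> 'd ell2) \<Rightarrow> (real set \<Rightarrow> 'd ell2 \<Rightarrow> 'd ell2) \<Rightarrow> bool" where
  "spectral_measure T E \<longleftrightarrow>
     (\<forall>M\<in>sets borel. orth_projection (E M)) \<and>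
     (\<exists>a b. \<forall>u. E {a..b} u = u) \<and> (\<forall>u. E UNIV u = u) \<and>
     (\<forall>M :: nat \<Rightarrow> real set. range M \<subseteq> sets borel \<longrightarrow> disjoint_family M \<longrightarrow>
        (\<forall>u. (\<lambda>k. E (M k) u) sums E (\<Union>k. M k) u)) \<and>
     (\<forall>u. cinner u (T u) = complex_of_real
        (\<integral>x. x \<partial>(measure_of UNIV (sets borel) (\<lambda>M. ennreal (Re (cinner u (E M u)))))))"

definition spectral_projection ::
    "('d::finite ell2 \<Rightarrow> 'd ell2) \<Rightarrow> real set \<Rightarrow> ('d ell2 \<Rightarrow> 'd ell2) \<Rightarrow> bool" where
  "spectral_projection T I P \<longleftrightarrow> (\<exists>E. spectral_measure T E \<and> P = E I)"

text \<open>Unbounded operators are represented by their graphs.\<close>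

definition adjoint_graph :: "('d::finite ell2 \<times> 'd ell2) set \<Rightarrow> ('d ell2 \<times> 'd ell2) set" where
  "adjoint_graph G = {(v, w). \<forall>(u, t)\<in>G. cinner t v = cinner u w}"

definition self_adjoint_graph :: "('d::finite ell2 \<times> 'd ell2) set \<Rightarrow> bool" where
  "self_adjoint_graph G \<longleftrightarrow> adjoint_graph G = G"

section \<open>The Molchanov-Vainberg Laplacian and the conjugate operators\<close>

lemma bij_translate: "bij (\<lambda>n :: int ^ 'd::finite. n - a)"
  by (rule bij_betw_byWitness[where f' = "\<lambda>n. n + a"]) auto

lift_definition shift :: "'d::finite \<Rightarrow> int \<Rightarrow> 'd ell2 \<Rightarrow> 'd ell2"
  is "\<lambda>i k u n. u (n - axis i k)"
  subgoal for i k u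
    using summable_on_reindex_bij_betw[OF bij_translate, of "\<lambda>n. (cmod (u n))\<^sup>2" "axis i k"] by simp
  done

definition Delta :: "'d::finite \<Rightarrow> 'd ell2 \<Rightarrow> 'd ell2" where
  "Delta i u = (1/2) *\<^sub>R (shift i 1 u + shift i (-1) u)"

text \<open>The product of the pairwise commuting operators \<open>Delta i\<close>.\<close>

definition mv_laplacian :: "'d::finite ell2 \<Rightarrow> 'd ell2" where
  "mv_laplacian = Finite_Set.fold (\<lambda>i T. Delta i \<circ> T) id UNIV"

lemma shift_adjoint: "cinner (shift i k u) v = cinner u (shift i (-k) v)"
proof -
  have "axis i (-k) = - axis i k" for i :: 'a
    by (simp add: axis_def vec_eq_iff)
  then show ?thesis
    unfolding cinner_def
    using infsum_reindex_bij_betw[OF bij_translate,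
        of "\<lambda>n. cnj (seq u n) * seq v (n + axis i k)" "axis i k"]
    by (simp add: shift.rep_eq)
qed

lemma Delta_commute: "Delta i \<circ> Delta j = Delta j \<circ> Delta i"
proof
  fix u
  show "(Delta i \<circ> Delta j) u = (Delta j \<circ> Delta i) u"
    by (rule ell2_eqI)
      (simp add: Delta_def plus_ell2.rep_eq scaleR_ell2.rep_eq shift.rep_eq algebra_simps)
qed

interpretation Delta_fold: comp_fun_commute "\<lambda>i T. Delta i \<circ> T"
  by unfold_locales (metis (no_types, lifting) Delta_commute comp_assoc comp_apply ext)

lemma mv_laplacian_2: "mv_laplacian (u :: 2 ell2) = Delta 1 (Delta 2 u)"
proof -
  have "Finite_Set.fold (\<lambda>i T. Delta i \<circ> T) id (insert (1 :: 2) (insert 2 {}))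
      = Delta 1 \<circ> (Delta 2 \<circ> id)"
    by (subst Delta_fold.fold_insert; simp)+
  then show ?thesis by (simp add: mv_laplacian_def UNIV_2)
qed

text \<open>\<open>conj_op i p \<kappa>\<close> is \<open>A\<^sub>i(p,\<kappa>)\<close>. It is only meaningful on finitely supported
  sequences, which form its initial domain.\<close>

definition pos_seq :: "'d::finite \<Rightarrow> (int ^ 'd \<Rightarrow> complex) \<Rightarrow> int ^ 'd \<Rightarrow> complex" where
  "pos_seq i u n = of_int (n $ i) * u n"

definition shift_diff_seq ::
    "'d::finite \<Rightarrow> int \<Rightarrow> (int ^ 'd \<Rightarrow> complex) \<Rightarrow> int ^ 'd \<Rightarrow> complex" where
  "shift_diff_seq i k u n = u (n - axis i k) - u (n + axis i k)"

definition conj_op :: "'d::finite \<Rightarrow> nat \<Rightarrow> nat \<Rightarrow> 'd ell2 \<Rightarrow> 'd ell2" where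
  "conj_op i p \<kappa> u = Abs_ell2 (\<lambda>n. 1 / (4 * \<i>) *
     (shift_diff_seq i (int (p * \<kappa>)) (pos_seq i (seq u)) n +
      pos_seq i (shift_diff_seq i (int (p * \<kappa>)) (seq u)) n))"

lemma seq_conj_op:
  assumes "fin_supp u"
  shows "seq (conj_op i p \<kappa> u) n = 1 / (4 * \<i>) *
     (shift_diff_seq i (int (p * \<kappa>)) (pos_seq i (seq u)) n +
      pos_seq i (shift_diff_seq i (int (p * \<kappa>)) (seq u)) n)"
proof -
  define a where "a = axis i (int (p * \<kappa>))"
  define f where "f = (\<lambda>n. 1 / (4 * \<i>) *
     (shift_diff_seq i (int (p * \<kappa>)) (pos_seq i (seq u)) n +
      pos_seq i (shift_diff_seq i (int (p * \<kappa>)) (seq u)) n))"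
  let ?S = "{n. seq u n \<noteq> 0}"
  have "{n. (cmod (f n))\<^sup>2 \<noteq> 0} \<subseteq> (\<lambda>n. n + a) ` ?S \<union> (\<lambda>n. n - a) ` ?S"
  proof
    fix n assume "n \<in> {n. (cmod (f n))\<^sup>2 \<noteq> 0}"
    then have "n - a \<in> ?S \<or> n + a \<in> ?S"
      by (auto simp: f_def pos_seq_def shift_diff_seq_def a_def)
    then show "n \<in> (\<lambda>n. n + a) ` ?S \<union> (\<lambda>n. n - a) ` ?S"
      using imageI[of "n - a" ?S "\<lambda>n. n + a"] imageI[of "n + a" ?S "\<lambda>n. n - a"]
      by (auto simp del: image_eqI)
  qed
  moreover have "finite ((\<lambda>n. n + a) ` ?S \<union> (\<lambda>n. n - a) ` ?S)"
    using assms by (simp add: fin_supp_def)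
  ultimately have "(\<lambda>n. (cmod (f n))\<^sup>2) summable_on UNIV"
    by (intro finite_nonzero_values_imp_summable_on) (auto intro: finite_subset)
  then have "seq (conj_op i p \<kappa> u) = f"
    unfolding conj_op_def f_def[symmetric] by (simp add: Abs_ell2_inverse)
  then show ?thesis by (simp add: f_def)
qed

definition conj_sum_op :: "nat \<Rightarrow> nat \<Rightarrow> 'd::finite ell2 \<Rightarrow> 'd ell2" where
  "conj_sum_op p \<kappa> u = (\<Sum>i\<in>UNIV. conj_op i p \<kappa> u)"

text \<open>Self-adjoint (finite or infinite) linear combinations: the series over \<open>p \<ge> 1\<close> converges
  strongly on the finitely supported sequences, and the closure of the resulting operator is
  self-adjoint. The value \<open>\<rho> 0\<close> is not used; finite combinations have \<open>\<rho> p = 0\<close> for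
  large \<open>p\<close>.\<close>

definition lin_comb :: "(nat \<Rightarrow> real) \<Rightarrow> nat \<Rightarrow> 'd::finite ell2 \<Rightarrow> 'd ell2" where
  "lin_comb \<rho> \<kappa> u = (\<Sum>k. \<rho> (Suc k) *\<^sub>R conj_sum_op (Suc k) \<kappa> u)"

definition self_adjoint_comb :: "'d::finite itself \<Rightarrow> (nat \<Rightarrow> real) \<Rightarrow> nat \<Rightarrow> bool" where
  "self_adjoint_comb d \<rho> \<kappa> \<longleftrightarrow>
     (\<forall>u :: 'd ell2. fin_supp u \<longrightarrow>
        summable (\<lambda>k. \<rho> (Suc k) *\<^sub>R conj_sum_op (Suc k) \<kappa> u)) \<and>
     self_adjoint_graph (closure {(u :: 'd ell2, lin_comb \<rho> \<kappa> u) | u. fin_supp u})"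

text \<open>\<open>B\<close> is the bounded extension of \<open>[D, \<i>A] = \<i>(DA - AD)\<close> from the finitely supported
  sequences, which are dense and are preserved by \<open>D\<close>.\<close>

definition commutator_ext ::
    "(nat \<Rightarrow> real) \<Rightarrow> nat \<Rightarrow> ('d::finite ell2 \<Rightarrow> 'd ell2) \<Rightarrow> bool" where
  "commutator_ext \<rho> \<kappa> B \<longleftrightarrow> bounded_clinear B \<and>
     (\<forall>u. fin_supp u \<longrightarrow>
        B u = scaleC \<i> (mv_laplacian (lin_comb \<rho> \<kappa> u) - lin_comb \<rho> \<kappa> (mv_laplacian u)))"

section \<open>Thresholds\<close>

text \<open>The interval around \<open>E\<close> has to be open: for \<open>I = {E}\<close> the spectral projection vanishes and
  the estimate is void.\<close>

definition mourre_set :: "'d::finite itself \<Rightarrow> nat \<Rightarrow> real set" where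
  "mourre_set d \<kappa> = {E. complex_of_real E \<in> spectrum (mv_laplacian :: 'd ell2 \<Rightarrow> 'd ell2) \<and>
     (\<exists>\<rho> (B :: 'd ell2 \<Rightarrow> 'd ell2) a b P \<gamma>.
        self_adjoint_comb d \<rho> \<kappa> \<and> commutator_ext \<rho> \<kappa> B \<and>
        a < E \<and> E < b \<and> spectral_projection mv_laplacian {a<..<b} P \<and> \<gamma> > 0 \<and>
        (\<forall>u. inner u (P (B (P u))) \<ge> \<gamma> * inner u (P u)))}"

definition threshold_set :: "'d::finite itself \<Rightarrow> nat \<Rightarrow> real set" where
  "threshold_set d \<kappa> =
     {E. complex_of_real E \<in> spectrum (mv_laplacian :: 'd ell2 \<Rightarrow> 'd ell2)} - mourre_set d \<kappa>"

fun cheb_T :: "nat \<Rightarrow> real \<Rightarrow> real" where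
  "cheb_T 0 x = 1"
| "cheb_T (Suc 0) x = x"
| "cheb_T (Suc (Suc n)) x = 2 * x * cheb_T (Suc n) x - cheb_T n x"

fun cheb_U :: "nat \<Rightarrow> real \<Rightarrow> real" where
  "cheb_U 0 x = 1"
| "cheb_U (Suc 0) x = 2 * x"
| "cheb_U (Suc (Suc n)) x = 2 * x * cheb_U (Suc n) x - cheb_U n x"

lemma cheb_T_cos: "cheb_T n (cos t) = cos (real n * t)"
proof (induction n "cos t" rule: cheb_T.induct)
  case (3 n)
  have "cos (real (Suc (Suc n)) * t) + cos (real n * t) = 2 * cos t * cos (real (Suc n) * t)"
    using cos_add[of "real (Suc n) * t" t] cos_diff[of "real (Suc n) * t" t]
    by (simp add: algebra_simps)
  with 3 show ?case by simp
qed auto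

lemma cheb_U_sin: "sin t * cheb_U n (cos t) = sin (real (Suc n) * t)"
proof (induction n "cos t" rule: cheb_U.induct)
  case 2
  then show ?case using sin_double[of t] by simp
next
  case (3 n)
  have "sin (real (Suc (Suc (Suc n))) * t) + sin (real (Suc n) * t)
      = 2 * cos t * sin (real (Suc (Suc n)) * t)"
    using sin_add[of "real (Suc (Suc n)) * t" t] sin_diff[of "real (Suc (Suc n)) * t" t]
    by (simp add: algebra_simps)
  with 3 show ?case by (simp add: algebra_simps)
qed auto

definition g_fun :: "nat \<Rightarrow> real ^ 'd::finite \<Rightarrow> real" where
  "g_fun k x = (\<Sum>i\<in>UNIV. (\<Prod>l\<in>UNIV - {i}. x $ l) * (1 - (x $ i)\<^sup>2) * cheb_U (k - 1) (x $ i))"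

definition energy_surface :: "real \<Rightarrow> (real ^ 'd::finite) set" where
  "energy_surface E = {x. (\<forall>l. x $ l \<in> {-1..1}) \<and> (\<Prod>l\<in>UNIV. x $ l) = E}"

definition threshold_set_m :: "'d::finite itself \<Rightarrow> nat \<Rightarrow> nat \<Rightarrow> real set" where
  "threshold_set_m d m \<kappa> = {E \<in> {-1..1}. \<exists>(x :: nat \<Rightarrow> real ^ 'd) \<omega> :: nat \<Rightarrow> real.
     (\<forall>q\<le>m. x q \<in> energy_surface E) \<and> (\<forall>q<m. \<omega> q \<le> 0) \<and>
     (\<forall>p\<ge>1. g_fun (p * \<kappa>) (x m) = (\<Sum>q<m. \<omega> q * g_fun (p * \<kappa>) (x q)))}"

text \<open>The relations \<open>X\<^sub>n\<^sub>-\<^sub>q = E / X\<^sub>1\<^sub>+\<^sub>q\<close>, whose index starts at \<open>q = -1\<close>, are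
  written with \<open>r = 1 + q\<close>.\<close>

definition Sigma_system :: "nat \<Rightarrow> nat \<Rightarrow> real \<Rightarrow> (nat \<Rightarrow> real) \<Rightarrow> bool" where
  "Sigma_system \<kappa> n E X \<longleftrightarrow>
     (if odd n
      then (\<forall>q\<le>(n - 1) div 2. cheb_T \<kappa> (X q) = cheb_T \<kappa> (X (n - q))) \<and>
           (\<forall>r\<le>(n + 1) div 2. X (n + 1 - r) = E / X r)
      else (\<forall>q<n div 2. cheb_T \<kappa> (X q) = cheb_T \<kappa> (X (n - q))) \<and>
           (\<forall>r\<le>n div 2. X (n + 1 - r) = E / X r))"

end

theory Submission
  imports Defs
begin

text \<open>The proof joins an operator-theoretic fact, valid in every dimension, to an elementary
construction in one real variable.

\<^bold>\<open>Cone relations are obstructions to the Mourre estimate.\<close> A combination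
\<open>\<Sum>\<^sub>p \<rho> p A\<^sub>p\<^sub>\<kappa>\<close> that is defined on the unit vector at the origin has
\<open>\<Sum>\<^sub>p (p \<rho> p)\<^sup>2 < \<infinity>\<close>, because the vectors \<open>A\<^sub>p\<^sub>\<kappa> \<delta>\<^sub>0\<close> have disjoint supports and
norms proportional to \<open>p\<close>; hence \<open>\<Sum>\<^sub>p \<bar>\<rho> p\<bar> < \<infinity>\<close> (\<open>self_adjoint_comb_summable\<close>). Each
commutator \<open>[D, \<i> A\<^sub>p\<^sub>\<kappa>]\<close> is a bounded polynomial in the shifts with symbol \<open>g\<^sub>p\<^sub>\<kappa>\<close>
(\<open>commutator_conj_sum_op\<close>, \<open>approx_eigen_comm_op\<close>). Truncated plane waves are approximate
eigenvectors of all shifts at once. Those whose frequency corresponds to a point \<open>x\<close> of the energy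
surface of \<open>E\<close> are asymptotically fixed by the spectral projection of \<open>D\<close> around \<open>E\<close>
(\<open>norm_spectral_defect_le\<close>), so testing the Mourre estimate on them gives
\<open>\<Sum>\<^sub>p \<rho> p g\<^sub>p\<^sub>\<kappa>(x) \<ge> \<gamma> > 0\<close> (\<open>mourre_estimate_on_energy_surface\<close>). A relation
\<open>g\<^sub>p\<^sub>\<kappa>(x\<^sub>m) = \<Sum>\<^sub>q \<omega>\<^sub>q g\<^sub>p\<^sub>\<kappa>(x\<^sub>q)\<close> with all \<open>\<omega>\<^sub>q \<le> 0\<close> makes the left-hand sum at \<open>x\<^sub>m\<close>
nonpositive, which is absurd (\<open>threshold_set_m_subset_threshold_set\<close>).

\<^bold>\<open>The energies.\<close> Put \<open>c\<^sub>i = cos (i \<pi> / \<kappa>)\<close>. The reflection \<open>R (cos t) = cos (2 j \<pi> / \<kappa> - t)\<close>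
exchanges the intervals \<open>[c\<^sub>j\<^sub>+\<^sub>1, c\<^sub>j]\<close> and \<open>[c\<^sub>j, c\<^sub>j\<^sub>-\<^sub>1]\<close>; it preserves \<open>T\<^sub>\<kappa>\<close> and changes the sign of
\<open>sin (p \<kappa> arccos x)\<close>. Starting from \<open>y\<^sub>0 = c\<^sub>j\<^sub>-\<^sub>1\<close> and iterating \<open>y\<^sub>k\<^sub>+\<^sub>1 = R (E / y\<^sub>k)\<close> solves the
relations of the system one after the other, with \<open>X\<^sub>k = E / y\<^sub>k\<close> and \<open>X\<^sub>n\<^sub>+\<^sub>1\<^sub>-\<^sub>k = y\<^sub>k\<close>. The chain
closes after \<open>m\<close> steps if \<open>E / y\<^sub>m = y\<^sub>m\<close> (for \<open>n = 2 m - 1\<close>) or \<open>E / y\<^sub>m = c\<^sub>j\<close> (for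
\<open>n = 2 m\<close>). With the ratios \<open>E / y\<^sub>k\<close> truncated at \<open>c\<^sub>j\<close>, all \<open>y\<^sub>k\<close> are
continuous and antitone in \<open>E\<close>, so the intermediate value theorem gives
\<open>E\<^sub>n\<close> (\<open>energy_root\<close>), and comparing consecutive closing conditions shows that the \<open>E\<^sub>n\<close>
decrease (\<open>energy_Suc_less\<close>).

\<^bold>\<open>The cone relation.\<close> At the point \<open>(E / y\<^sub>q, y\<^sub>q)\<close> the sign change under \<open>R\<close> turns
\<open>g\<^sub>p\<^sub>\<kappa>\<close> into \<open>a\<^sub>q F\<^sub>q - b\<^sub>q F\<^sub>q\<^sub>-\<^sub>1\<close> with \<open>F\<^sub>q = sin (p \<kappa> arccos (E / y\<^sub>q))\<close>, \<open>a\<^sub>q > 0\<close> and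
\<open>b\<^sub>q \<ge> 0\<close>. Solving this bidiagonal system writes \<open>F\<^sub>m\<^sub>-\<^sub>1\<close> as a nonnegative combination of the
first \<open>m\<close> values of \<open>g\<^sub>p\<^sub>\<kappa>\<close> (\<open>bidiagonal_cone\<close>), while either closing condition makes the last value
a nonpositive multiple of \<open>F\<^sub>m\<^sub>-\<^sub>1\<close> (\<open>energy_in_threshold_set_m\<close>).\<close>


section \<open>Norm, coordinates and shifts on the sequence space\<close>

lemma norm_ell2_power2: "(norm u)\<^sup>2 = (\<Sum>\<^sub>\<infinity>n. (cmod (seq u n))\<^sup>2)"
proof -
  have "(norm u)\<^sup>2 = Re (cinner u u)"
    by (simp add: power2_norm_eq_inner inner_ell2_def)
  also have "\<dots> = (\<Sum>\<^sub>\<infinity>n. Re (cnj (seq u n) * seq u n))"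
    unfolding cinner_def by (rule infsum_Re[OF cinner_summable, symmetric])
  also have "\<dots> = (\<Sum>\<^sub>\<infinity>n. (cmod (seq u n))\<^sup>2)"
    by (rule infsum_cong) (simp add: cmod_power2, simp add: power2_eq_square)
  finally show ?thesis .
qed

lemma norm_ell2_power2_finite:
  assumes "finite S" "\<And>n. n \<notin> S \<Longrightarrow> seq u n = 0"
  shows "(norm u)\<^sup>2 = (\<Sum>n\<in>S. (cmod (seq u n))\<^sup>2)"
proof -
  have "(norm u)\<^sup>2 = (\<Sum>\<^sub>\<infinity>n\<in>S. (cmod (seq u n))\<^sup>2)"
    unfolding norm_ell2_power2 using assms by (intro infsum_cong_neutral) auto
  then show ?thesis using assms by simp
qed

lemma cmod_seq_le_norm: "cmod (seq u n) \<le> norm u"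
proof -
  have "(\<Sum>k\<in>{n}. (cmod (seq u k))\<^sup>2) \<le> (\<Sum>\<^sub>\<infinity>k. (cmod (seq u k))\<^sup>2)"
    by (intro finite_sum_le_infsum) (auto simp: seq_summable)
  then have "(cmod (seq u n))\<^sup>2 \<le> (norm u)\<^sup>2" by (simp add: norm_ell2_power2)
  then show ?thesis by (rule power2_le_imp_le) simp
qed

lemma bounded_linear_seq: "bounded_linear (\<lambda>u. seq u n)"
  by (rule bounded_linear_intro[where K = 1])
    (simp_all add: plus_ell2.rep_eq scaleR_ell2.rep_eq scaleR_conv_of_real cmod_seq_le_norm)

lemmas seq_simps = plus_ell2.rep_eq minus_ell2.rep_eq uminus_ell2.rep_eq zero_ell2.rep_eq
  scaleR_ell2.rep_eq scaleC.rep_eq shift.rep_eq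

lemma norm_scaleC: "norm (scaleC c u) = cmod c * norm u"
proof -
  have "(norm (scaleC c u))\<^sup>2 = (cmod c * norm u)\<^sup>2"
    by (simp add: norm_ell2_power2 seq_simps norm_mult power_mult_distrib infsum_cmult_right')
  then show ?thesis by (simp add: power2_eq_iff_nonneg)
qed

lemma scaleC_of_real: "scaleC (of_real r) u = r *\<^sub>R u"
  by (rule ell2_eqI) (simp add: seq_simps)

lemma scaleC_scaleC: "scaleC c (scaleC d u) = scaleC (c * d) u"
  by (rule ell2_eqI) (simp add: seq_simps)

lemma scaleC_add_left: "scaleC (c + d) u = scaleC c u + scaleC d u"
  by (rule ell2_eqI) (simp add: seq_simps algebra_simps)

lemma bounded_linear_scaleC: "bounded_linear (scaleC c)"
  by (rule bounded_linear_intro[where K = "cmod c"])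
    (auto intro!: ell2_eqI simp: seq_simps algebra_simps norm_scaleC)

lemma scaleC_diff_right: "scaleC c (u - v) = scaleC c u - scaleC c v"
  by (rule ell2_eqI) (simp add: seq_simps algebra_simps)

lemma scaleC_add_right: "scaleC c (u + v) = scaleC c u + scaleC c v"
  by (rule ell2_eqI) (simp add: seq_simps algebra_simps)

lemma norm_shift: "norm (shift i k u) = norm u"
proof -
  have "(norm (shift i k u))\<^sup>2 = (norm u)\<^sup>2"
    unfolding norm_ell2_power2 shift.rep_eq
    by (rule infsum_reindex_bij_betw[OF bij_translate])
  then show ?thesis by (simp add: power2_eq_iff_nonneg)
qed

lemma axis_add: "axis i (a + b) = axis i a + axis i (b :: int)"
  by (simp add: axis_def vec_eq_iff)

lemma axis_minus: "axis i (- a) = - axis i (a :: int)"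
  by (simp add: axis_def vec_eq_iff)

lemma shift_shift: "shift i k (shift i l u) = shift i (k + l) u"
  by (rule ell2_eqI) (simp add: seq_simps axis_add algebra_simps)

lemma axis_0: "axis i 0 = (0 :: int ^ 'd::finite)"
  by (simp add: axis_def vec_eq_iff)

lemma shift_0: "shift i 0 u = u"
  by (rule ell2_eqI) (simp add: seq_simps axis_0)

lemma bounded_clinear_shift: "bounded_clinear (shift i k)"
  unfolding bounded_clinear_def
proof (intro conjI allI)
  show "bounded_linear (shift i k)"
    by (rule bounded_linear_intro[where K = 1])
      (auto intro!: ell2_eqI simp: seq_simps norm_shift)
  show "shift i k (scaleC c u) = scaleC c (shift i k u)" for c u
    by (rule ell2_eqI) (simp add: seq_simps)
qed

lemma bounded_clinear_add:
  "bounded_clinear S \<Longrightarrow> bounded_clinear T \<Longrightarrow> bounded_clinear (\<lambda>u. S u + T u)"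
  by (simp add: bounded_clinear_def bounded_linear_add scaleC_add_right)

lemma bounded_clinear_scaleR:
  "bounded_clinear T \<Longrightarrow> bounded_clinear (\<lambda>u. r *\<^sub>R T u)"
  unfolding bounded_clinear_def
  by (auto intro!: bounded_linear_const_scaleR ell2_eqI simp: seq_simps)

lemma bounded_clinear_compose:
  "bounded_clinear S \<Longrightarrow> bounded_clinear T \<Longrightarrow> bounded_clinear (\<lambda>u. S (T u))"
  by (simp add: bounded_clinear_def bounded_linear_compose)

lemma bounded_clinear_Delta: "bounded_clinear (Delta i)"
  unfolding Delta_def[abs_def]
  by (intro bounded_clinear_scaleR bounded_clinear_add bounded_clinear_shift)

lemma inner_Delta: "inner (Delta i u) v = inner u (Delta i v)"
proof -
  have "inner (shift i k u) v = inner u (shift i (- k) v)" for k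
    by (simp add: inner_ell2_def shift_adjoint)
  from this[of 1] this[of "-1"] show ?thesis
    by (simp add: Delta_def inner_add)
qed

lemma norm_Delta_le: "norm (Delta i u) \<le> norm u"
  using norm_triangle_ineq[of "shift i 1 u" "shift i (-1) u"] by (simp add: Delta_def norm_shift)

section \<open>Partial products of the Laplacian\<close>

definition Delta_prod :: "'d::finite set \<Rightarrow> 'd ell2 \<Rightarrow> 'd ell2" where
  "Delta_prod S = Finite_Set.fold (\<lambda>i T. Delta i \<circ> T) id S"

lemma Delta_prod_empty: "Delta_prod {} = id"
  by (simp add: Delta_prod_def)

lemma Delta_prod_insert: "i \<notin> S \<Longrightarrow> Delta_prod (insert i S) = Delta i \<circ> Delta_prod S"
  by (simp add: Delta_prod_def Delta_fold.fold_insert)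

lemma mv_laplacian_split: "mv_laplacian u = Delta i (Delta_prod (UNIV - {i}) u)"
proof -
  have "mv_laplacian = Delta_prod (insert i (UNIV - {i}))"
    by (simp add: mv_laplacian_def Delta_prod_def insert_UNIV insert_absorb)
  also have "\<dots> = Delta i \<circ> Delta_prod (UNIV - {i})"
    by (rule Delta_prod_insert) simp
  finally show ?thesis by (metis comp_apply)
qed

lemma Delta_prod_Delta: "Delta_prod S (Delta i u) = Delta i (Delta_prod S u)"
  using finite[of S]
proof (induction S)
  case (insert l S)
  then show ?case
    using fun_cong[OF Delta_commute[of l i], of "Delta_prod S u"]
    by (simp add: Delta_prod_insert)
qed (simp add: Delta_prod_empty)

lemma bounded_clinear_Delta_prod: "bounded_clinear (Delta_prod S)"
  using finite[of S]
proof (induction S)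
  case empty
  then show ?case by (simp add: Delta_prod_empty bounded_clinear_def bounded_linear_ident id_def)
next
  case (insert l S)
  then show ?case
    using bounded_clinear_compose[OF bounded_clinear_Delta[of l] insert.IH]
    by (simp add: Delta_prod_insert comp_def)
qed

lemma inner_Delta_prod: "inner (Delta_prod S u) v = inner u (Delta_prod S v)"
  using finite[of S]
proof (induction S arbitrary: u)
  case (insert l S)
  then show ?case
    by (simp add: Delta_prod_insert inner_Delta flip: Delta_prod_Delta)
qed (simp add: Delta_prod_empty)

lemma norm_Delta_prod_le: "norm (Delta_prod S u) \<le> norm u"
  using finite[of S]
proof (induction S)
  case (insert l S)
  then show ?case
    using norm_Delta_le[of l "Delta_prod S u"] by (simp add: Delta_prod_insert)
qed (simp add: Delta_prod_empty)

lemma mv_laplacian_eq: "mv_laplacian = Delta_prod UNIV"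
  by (simp add: mv_laplacian_def Delta_prod_def)

section \<open>Approximate eigenvectors\<close>

text \<open>Fixing the sequence \<open>v\<close> makes the relation multiplicative in the operator: the symbol of any
polynomial in the shifts is found by substituting the eigenvalues of the shifts.\<close>

definition approx_eigen ::
    "(nat \<Rightarrow> 'd::finite ell2) \<Rightarrow> ('d ell2 \<Rightarrow> 'd ell2) \<Rightarrow> complex \<Rightarrow> bool" where
  "approx_eigen v T z \<longleftrightarrow> (\<lambda>N. T (v N) - scaleC z (v N)) \<longlonglongrightarrow> 0"

lemma approx_eigen_id: "approx_eigen v (\<lambda>u. u) 1"
proof -
  have "scaleC 1 u = u" for u :: "'a ell2" by (rule ell2_eqI) (simp add: seq_simps)
  then show ?thesis by (simp add: approx_eigen_def)
qed

lemma approx_eigen_add: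
  assumes "approx_eigen v S z" "approx_eigen v T w"
  shows "approx_eigen v (\<lambda>u. S u + T u) (z + w)"
  using tendsto_add[OF assms[unfolded approx_eigen_def]]
  by (simp add: approx_eigen_def scaleC_add_left algebra_simps)

lemma approx_eigen_compose:
  assumes "bounded_clinear S" "approx_eigen v S z" "approx_eigen v T w"
  shows "approx_eigen v (\<lambda>u. S (T u)) (z * w)"
proof -
  interpret bounded_linear S using assms by (simp add: bounded_clinear_def)
  have S: "S (scaleC c u) = scaleC c (S u)" for c u
    using assms by (simp add: bounded_clinear_def)
  have "(\<lambda>N. S (T (v N) - scaleC w (v N)) + scaleC w (S (v N) - scaleC z (v N)))
      \<longlonglongrightarrow> 0 + 0"
    using assms unfolding approx_eigen_def
    by (intro tendsto_add tendsto_zero bounded_linear.tendsto_zero[OF bounded_linear_scaleC])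
  then show ?thesis
    by (simp add: approx_eigen_def diff S scaleC_diff_right scaleC_scaleC algebra_simps)
qed

lemma approx_eigen_scaleC:
  assumes "approx_eigen v T z"
  shows "approx_eigen v (\<lambda>u. scaleC c (T u)) (c * z)"
  using bounded_linear.tendsto_zero[OF bounded_linear_scaleC[of c] assms[unfolded approx_eigen_def]]
  by (simp add: approx_eigen_def scaleC_diff_right scaleC_scaleC)

text \<open>Positive powers follow by composition. A negative power is obtained by applying the bounded
inverse to the relation for the corresponding positive power.\<close>

lemma approx_eigen_shift:
  assumes "approx_eigen v (shift i 1) z" "cmod z = 1"
  shows "approx_eigen v (shift i k) (z powi k)"
proof -
  have z: "z \<noteq> 0" using assms by auto
  have nat: "approx_eigen v (shift i (int m)) (z ^ m)" for m
  proof (induction m)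
    case 0
    then show ?case using approx_eigen_id[of v] by (simp add: shift_0)
  next
    case (Suc m)
    show ?case
      using approx_eigen_compose[OF bounded_clinear_shift assms(1) Suc.IH]
      by (simp add: shift_shift)
  qed
  show ?thesis
  proof (cases "k \<ge> 0")
    case True
    then show ?thesis using nat[of "nat k"] by (simp add: power_int_def)
  next
    case False
    define m where "m = nat (- k)"
    have k: "k = - int m" using False by (simp add: m_def)
    interpret bounded_linear "shift i k"
      using bounded_clinear_shift[of i k] by (simp add: bounded_clinear_def)
    have "(\<lambda>N. scaleC (- inverse (z ^ m)) (shift i k (shift i (int m) (v N) - scaleC (z ^ m) (v N))))
        \<longlonglongrightarrow> 0"
      using nat[of m] unfolding approx_eigen_def
      by (intro bounded_linear.tendsto_zero[OF bounded_linear_scaleC] tendsto_zero)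
    moreover have "scaleC (- inverse (z ^ m)) (shift i k (shift i (int m) u - scaleC (z ^ m) u))
        = shift i k u - scaleC (z powi k) u" for u
      using z by (intro ell2_eqI)
        (simp add: diff shift_shift shift_0 k, simp add: seq_simps axis_0 axis_minus field_simps power_int_minus)
    ultimately show ?thesis by (simp add: approx_eigen_def)
  qed
qed

section \<open>Plane waves on boxes\<close>

definition lattice_box :: "nat \<Rightarrow> (int ^ 'd::finite) set" where
  "lattice_box N = {n. \<forall>l. n $ l \<in> {0..<int N}}"

lemma
  assumes "\<And>l. finite (A l)"
  shows finite_product_set_vec: "finite {n :: int ^ 'd::finite. \<forall>l. n $ l \<in> A l}"
    and card_product_set_vec: "card {n :: int ^ 'd. \<forall>l. n $ l \<in> A l} = (\<Prod>l\<in>UNIV. card (A l))"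
proof -
  have eq: "{n :: int ^ 'd::finite. \<forall>l. n $ l \<in> A l} = vec_lambda ` (PiE UNIV A)"
  proof (intro equalityI subsetI)
    fix n :: "int ^ 'd" assume "n \<in> {n. \<forall>l. n $ l \<in> A l}"
    then have "vec_nth n \<in> PiE UNIV A" by auto
    then show "n \<in> vec_lambda ` (PiE UNIV A)"
      by (metis image_eqI vec_nth_inverse)
  qed (auto simp: PiE_def)
  have inj: "inj_on vec_lambda (PiE UNIV A)"
    by (metis inj_on_inverseI UNIV_I vec_lambda_inverse)
  show "finite {n :: int ^ 'd::finite. \<forall>l. n $ l \<in> A l}"
    unfolding eq using assms by (simp add: finite_PiE)
  show "card {n :: int ^ 'd. \<forall>l. n $ l \<in> A l} = (\<Prod>l\<in>UNIV. card (A l))"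
    unfolding eq using inj by (simp add: card_image card_PiE)
qed

lemma finite_box: "finite (lattice_box N)"
  unfolding lattice_box_def by (rule finite_product_set_vec) simp

lemma card_box: "card (lattice_box N :: (int ^ 'd::finite) set) = N ^ CARD('d)"
  unfolding lattice_box_def by (subst card_product_set_vec) simp_all

definition plane_wave :: "real ^ 'd::finite \<Rightarrow> nat \<Rightarrow> 'd ell2" where
  "plane_wave \<theta> N = Abs_ell2 (\<lambda>n. if n \<in> lattice_box N then cis (\<Sum>l\<in>UNIV. of_int (n $ l) * \<theta> $ l) else 0)"

lemma seq_plane_wave:
  "seq (plane_wave \<theta> N) n = (if n \<in> lattice_box N then cis (\<Sum>l\<in>UNIV. of_int (n $ l) * \<theta> $ l) else 0)"
proof -
  have "(\<lambda>n. (cmod (if n \<in> lattice_box N then cis (\<Sum>l\<in>UNIV. of_int (n $ l) * \<theta> $ l) else 0))\<^sup>2) summable_on UNIV"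
    by (rule finite_nonzero_values_imp_summable_on) (auto intro: finite_subset[OF _ finite_box[of N]])
  then show ?thesis by (simp add: plane_wave_def Abs_ell2_inverse)
qed

lemma norm_plane_wave:
  "(norm (plane_wave \<theta> N :: 'd::finite ell2))\<^sup>2 = real N ^ CARD('d)"
  by (subst norm_ell2_power2_finite[OF finite_box[of N]]) (auto simp: seq_plane_wave card_box)

lemma fin_supp_plane_wave: "fin_supp (plane_wave \<theta> N)"
  unfolding fin_supp_def by (rule finite_subset[OF _ finite_box[of N]]) (auto simp: seq_plane_wave)

text \<open>The shift multiplies a plane wave by a phase except on the two faces of the box orthogonal to
\<open>axis i 1\<close>, where one of the two terms vanishes. The faces are smaller than the box by a factor \<open>N\<close>,
which makes the normalised waves approximate eigenvectors.\<close>

lemma norm_shift_plane_wave: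
  fixes \<theta> :: "real ^ 'd::finite"
  shows "(norm (shift i 1 (plane_wave \<theta> N) - scaleC (cis (- \<theta> $ i)) (plane_wave \<theta> N)))\<^sup>2
    \<le> 2 * real N ^ (CARD('d) - 1)"
proof -
  define A where "A l = (if l = i then {0, int N} else {0..<int N})" for l
  define S where "S = {n :: int ^ 'd. \<forall>l. n $ l \<in> A l}"
  define w where "w = shift i 1 (plane_wave \<theta> N) - scaleC (cis (- \<theta> $ i)) (plane_wave \<theta> N)"
  have finA: "finite (A l)" for l by (simp add: A_def)
  have phase: "(\<Sum>l\<in>UNIV. of_int ((n - axis i 1) $ l) * \<theta> $ l)
      = (\<Sum>l\<in>UNIV. of_int (n $ l) * \<theta> $ l) - \<theta> $ i" for n :: "int ^ 'd"
  proof -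
    have "(\<Sum>l\<in>UNIV. of_int ((n - axis i 1) $ l) * \<theta> $ l)
        = (\<Sum>l\<in>UNIV. of_int (n $ l) * \<theta> $ l - (if l = i then \<theta> $ i else 0))"
      by (intro sum.cong) (auto simp: axis_def algebra_simps)
    then show ?thesis by (simp add: sum_subtractf)
  qed
  have seq_w: "seq w n = cis ((\<Sum>l\<in>UNIV. of_int (n $ l) * \<theta> $ l) - \<theta> $ i) *
      (of_bool (n - axis i 1 \<in> lattice_box N) - of_bool (n \<in> lattice_box N))" for n
    using phase[of n] by (simp add: w_def seq_simps seq_plane_wave cis_mult)
  have "seq w n = 0" if "n \<notin> S" for n
  proof -
    define others where "others \<longleftrightarrow> (\<forall>l. l \<noteq> i \<longrightarrow> n $ l \<in> {0..<int N})"
    have split_at_i: "(\<forall>l. Q l) \<longleftrightarrow> (\<forall>l. l \<noteq> i \<longrightarrow> Q l) \<and> Q i" for Q by metis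
    have "n \<in> lattice_box N \<longleftrightarrow> others \<and> n $ i \<in> {0..<int N}"
      unfolding lattice_box_def others_def mem_Collect_eq by (rule split_at_i)
    moreover have "n - axis i 1 \<in> lattice_box N \<longleftrightarrow> others \<and> n $ i \<in> {1..int N}"
      unfolding lattice_box_def others_def mem_Collect_eq by (subst split_at_i) (auto simp: axis_def)
    moreover have "n \<in> S \<longleftrightarrow> others \<and> n $ i \<in> {0, int N}"
      unfolding S_def A_def others_def mem_Collect_eq by (subst split_at_i) auto
    ultimately have "n - axis i 1 \<in> lattice_box N \<longleftrightarrow> n \<in> lattice_box N"
      using that by auto
    then show ?thesis by (simp add: seq_w)
  qed
  moreover have "finite S" using finite_product_set_vec[of A] finA by (simp add: S_def)
  ultimately have "(norm w)\<^sup>2 = (\<Sum>n\<in>S. (cmod (seq w n))\<^sup>2)" 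
    by (intro norm_ell2_power2_finite) 
  also have "\<dots> \<le> (\<Sum>n\<in>S. 1)"
    by (intro sum_mono) (auto simp: seq_w norm_mult)
  also have "\<dots> = (\<Prod>l\<in>UNIV. real (card (A l)))"
    using finA by (simp add: S_def card_product_set_vec)
  also have "\<dots> = real (card (A i)) * (\<Prod>l\<in>UNIV - {i}. real (card (A l)))"
    by (simp add: prod.remove)
  also have "(\<Prod>l\<in>UNIV - {i}. real (card (A l))) = (\<Prod>l\<in>UNIV - {i}. real N)"
    by (intro prod.cong) (auto simp: A_def)
  also have "\<dots> = real N ^ (CARD('d) - 1)"
    by (simp add: card_Diff_singleton)
  also have "real (card (A i)) * real N ^ (CARD('d) - 1) \<le> 2 * real N ^ (CARD('d) - 1)"
    by (intro mult_right_mono) (auto simp: A_def card_insert_if)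
  finally show ?thesis by (simp add: w_def)
qed

definition wave_packet :: "real ^ 'd::finite \<Rightarrow> nat \<Rightarrow> 'd ell2" where
  "wave_packet \<theta> N = (1 / norm (plane_wave \<theta> (Suc N))) *\<^sub>R plane_wave \<theta> (Suc N)"

lemma norm_plane_wave_pos:
  assumes "N > 0"
  shows "norm (plane_wave \<theta> N) > 0"
proof -
  have "(norm (plane_wave \<theta> N))\<^sup>2 \<noteq> 0"
    unfolding norm_plane_wave using assms by simp
  then show ?thesis by simp
qed

lemma norm_wave_packet: "norm (wave_packet \<theta> N) = 1"
  using norm_plane_wave_pos[of "Suc N" \<theta>] by (simp add: wave_packet_def)

lemma fin_supp_scaleR: "fin_supp u \<Longrightarrow> fin_supp (r *\<^sub>R u)"
  unfolding fin_supp_def by (erule rev_finite_subset) (auto simp: seq_simps)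

lemma fin_supp_wave_packet: "fin_supp (wave_packet \<theta> N)"
  by (simp add: wave_packet_def fin_supp_scaleR fin_supp_plane_wave)

lemma approx_eigen_wave_packet:
  fixes \<theta> :: "real ^ 'd::finite"
  shows "approx_eigen (wave_packet \<theta>) (shift i 1) (cis (- \<theta> $ i))"
proof -
  let ?w = "\<lambda>N. shift i 1 (wave_packet \<theta> N) - scaleC (cis (- \<theta> $ i)) (wave_packet \<theta> N)"
  have bound: "(norm (?w N))\<^sup>2 \<le> 2 / real (Suc N)" for N
  proof -
    let ?p = "plane_wave \<theta> (Suc N)"
    define e where "e = CARD('d) - 1"
    have e: "CARD('d) = Suc e" by (simp add: e_def)
    have "?w N = (1 / norm ?p) *\<^sub>R (shift i 1 ?p - scaleC (cis (- \<theta> $ i)) ?p)"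
      by (rule ell2_eqI) (simp add: wave_packet_def seq_simps algebra_simps)
    then have "(norm (?w N))\<^sup>2 = (norm (shift i 1 ?p - scaleC (cis (- \<theta> $ i)) ?p))\<^sup>2 / (norm ?p)\<^sup>2"
      by (simp add: power_divide)
    also have "\<dots> \<le> (2 * real (Suc N) ^ e) / (norm ?p)\<^sup>2"
      unfolding e_def by (intro divide_right_mono norm_shift_plane_wave) simp
    also have "(norm ?p)\<^sup>2 = real (Suc N) ^ Suc e"
      by (simp only: norm_plane_wave e)
    also have "2 * real (Suc N) ^ e / real (Suc N) ^ Suc e = 2 / real (Suc N)"
      by (simp del: of_nat_Suc)
    finally show ?thesis .
  qed
  have "(\<lambda>N. 2 / real (Suc N)) \<longlonglongrightarrow> 0"
    using LIMSEQ_Suc[OF lim_const_over_n[of 2]] by simp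
  then have "(\<lambda>N. (norm (?w N))\<^sup>2) \<longlonglongrightarrow> 0"
    by (rule tendsto_sandwich[OF _ _ tendsto_const, rotated 2]) (use bound in auto)
  then have "(\<lambda>N. sqrt ((norm (?w N))\<^sup>2)) \<longlonglongrightarrow> sqrt 0"
    by (rule tendsto_real_sqrt)
  then show ?thesis by (simp add: approx_eigen_def tendsto_norm_zero_iff)
qed

lemma approx_eigen_wave_packet_shift:
  "approx_eigen (wave_packet \<theta>) (shift i k) (cis (- of_int k * \<theta> $ i))"
proof -
  have "approx_eigen (wave_packet \<theta>) (shift i k) (cis (- \<theta> $ i) powi k)"
    by (rule approx_eigen_shift[OF approx_eigen_wave_packet]) simp
  then show ?thesis by (simp add: cis_power_int)
qed

lemma approx_eigen_Delta:
  "approx_eigen (wave_packet \<theta>) (Delta i) (of_real (cos (\<theta> $ i)))"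
proof -
  have "approx_eigen (wave_packet \<theta>) (\<lambda>u. scaleC (1/2) (shift i 1 u + shift i (-1) u))
      (1/2 * (cis (- of_int 1 * \<theta> $ i) + cis (- of_int (-1) * \<theta> $ i)))"
    by (intro approx_eigen_scaleC approx_eigen_add approx_eigen_wave_packet_shift)
  moreover have "scaleC (1/2) u = (1/2) *\<^sub>R u" for u :: "'a ell2"
    using scaleC_of_real[of "1/2" u] by simp
  moreover have "1/2 * (cis (- of_int 1 * \<theta> $ i) + cis (- of_int (-1) * \<theta> $ i)) = of_real (cos (\<theta> $ i))"
    by (simp add: complex_eq_iff)
  ultimately show ?thesis by (simp add: Delta_def[abs_def])
qed

lemma approx_eigen_Delta_prod:
  "approx_eigen (wave_packet \<theta>) (Delta_prod S) (of_real (\<Prod>l\<in>S. cos (\<theta> $ l)))"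
  using finite[of S]
proof (induction S)
  case empty
  then show ?case using approx_eigen_id by (simp add: Delta_prod_empty id_def)
next
  case (insert l S)
  then show ?case
    using approx_eigen_compose[OF bounded_clinear_Delta approx_eigen_Delta insert.IH]
    by (simp add: Delta_prod_insert comp_def)
qed

section \<open>Spectral projections and approximate eigenvectors\<close>

context
  fixes T :: "'d::finite ell2 \<Rightarrow> 'd ell2" and F :: "real set \<Rightarrow> 'd ell2 \<Rightarrow> 'd ell2"
  assumes spectral: "spectral_measure T F"
begin

lemma spectral_orth_projection: "M \<in> sets borel \<Longrightarrow> orth_projection (F M)"
  using spectral unfolding spectral_measure_def by blast

lemma spectral_linear: "M \<in> sets borel \<Longrightarrow> bounded_linear (F M)"
  using spectral_orth_projection unfolding orth_projection_def bounded_clinear_def by blast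

lemma spectral_idem: "M \<in> sets borel \<Longrightarrow> F M (F M u) = F M u"
  using spectral_orth_projection unfolding orth_projection_def by blast

lemma spectral_symmetric: "M \<in> sets borel \<Longrightarrow> inner (F M u) v = inner u (F M v)"
  using spectral_orth_projection unfolding orth_projection_def inner_ell2_def by metis

lemma spectral_UNIV: "F UNIV u = u"
  using spectral unfolding spectral_measure_def by blast

lemma spectral_sums:
  "range M \<subseteq> sets borel \<Longrightarrow> disjoint_family M \<Longrightarrow> (\<lambda>k. F (M k) u) sums F (\<Union>k. M k) u"
  for M :: "nat \<Rightarrow> real set"
  using spectral unfolding spectral_measure_def by blast

lemma spectral_empty: "F {} u = 0"
proof -
  have "(\<lambda>k::nat. F {} u) sums F (\<Union>k::nat. {}) u"
    by (rule spectral_sums) (auto simp: disjoint_family_on_def)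
  then have "(\<lambda>k::nat. F {} u) \<longlonglongrightarrow> 0"
    using sums_summable summable_LIMSEQ_zero by blast
  then show ?thesis by (simp add: LIMSEQ_const_iff)
qed

lemma spectral_Un:
  assumes "A \<in> sets borel" "B \<in> sets borel" "A \<inter> B = {}"
  shows "F (A \<union> B) u = F A u + F B u"
proof -
  define M :: "nat \<Rightarrow> real set" where "M k = (if k = 0 then A else if k = 1 then B else {})" for k
  have "(\<lambda>k. F (M k) u) sums F (\<Union>k. M k) u"
    using assms by (intro spectral_sums) (auto simp: M_def disjoint_family_on_def)
  moreover have "(\<lambda>k. F (M k) u) sums (\<Sum>k\<in>{0,1}. F (M k) u)"
    by (rule sums_finite) (auto simp: M_def spectral_empty)
  moreover have "(\<Union>k. M k) = A \<union> B" by (auto simp: M_def split: if_splits)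
  ultimately show ?thesis using sums_unique2 by (fastforce simp: M_def)
qed

text \<open>If \<open>P\<close>, \<open>Q\<close> and \<open>P + Q\<close> are all idempotent then \<open>P Q + Q P = 0\<close>. Multiplying by \<open>P\<close> on either
side shows \<open>P Q = Q P\<close>, so both vanish.\<close>

lemma spectral_disjoint:
  assumes A: "A \<in> sets borel" and B: "B \<in> sets borel" and "A \<inter> B = {}"
  shows "F A (F B u) = 0"
proof -
  interpret FA: bounded_linear "F A" by (rule spectral_linear[OF A])
  interpret FB: bounded_linear "F B" by (rule spectral_linear[OF B])
  have anti: "F A (F B u) + F B (F A u) = 0" for u
    using spectral_idem[of "A \<union> B" u] A B assms(3)
    by (simp add: spectral_Un FA.add FB.add spectral_idem)
  have "F A (F B u) + F A (F B (F A u)) = 0"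
    using anti[of u, THEN arg_cong[of _ _ "F A"]] A by (simp add: FA.add spectral_idem FA.zero)
  moreover have "F A (F B (F A u)) + F B (F A u) = 0"
    using anti[of "F A u"] A by (simp add: spectral_idem)
  ultimately have "F A (F B u) = F B (F A u)"
    by (metis add.commute add_left_imp_eq)
  with anti[of u] have "2 *\<^sub>R F A (F B u) = 0" by (simp add: scaleR_2)
  then show ?thesis by simp
qed

lemma spectral_Int:
  assumes A: "A \<in> sets borel" and B: "B \<in> sets borel"
  shows "F A (F B u) = F (A \<inter> B) u"
proof -
  interpret FA: bounded_linear "F A" by (rule spectral_linear[OF A])
  have I: "A \<inter> B \<in> sets borel" "A - B \<in> sets borel" "B - A \<in> sets borel"
    using A B by auto
  have "F B u = F (A \<inter> B) u + F (B - A) u"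
  proof -
    have "B = A \<inter> B \<union> (B - A)" by auto
    then show ?thesis using spectral_Un[of "A \<inter> B" "B - A" u] I by auto
  qed
  moreover have "F A (F (B - A) u) = 0"
    by (rule spectral_disjoint) (use A I in auto)
  moreover have "F A (F (A \<inter> B) u) = F (A \<inter> B) u"
  proof -
    have "A = A \<inter> B \<union> (A - B)" by auto
    then have "F A w = F (A \<inter> B) w + F (A - B) w" for w
      using spectral_Un[of "A \<inter> B" "A - B" w] I by auto
    moreover have "F (A - B) (F (A \<inter> B) u) = 0"
      by (rule spectral_disjoint) (use I in auto)
    ultimately show ?thesis using I by (simp add: spectral_idem)
  qed
  ultimately show ?thesis by (simp add: FA.add)
qed

definition spectral_distr :: "'d ell2 \<Rightarrow> real measure" where
  "spectral_distr u = measure_of UNIV (sets borel) (\<lambda>M. ennreal (Re (cinner u (F M u))))"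

lemma sets_spectral_distr [measurable_cong, simp]: "sets (spectral_distr u) = sets borel"
  and space_spectral_distr [simp]: "space (spectral_distr u) = UNIV"
  using sigma_algebra.sets_measure_of_eq[OF sets.sigma_algebra_axioms[of borel]]
  by (simp_all add: spectral_distr_def space_measure_of_conv sets_measure_of_conv) 

lemma inner_spectral: "M \<in> sets borel \<Longrightarrow> inner u (F M u) = (norm (F M u))\<^sup>2"
  using spectral_symmetric[of M u "F M u"] by (simp add: spectral_idem power2_norm_eq_inner)

lemma emeasure_spectral_distr:
  assumes "M \<in> sets borel"
  shows "emeasure (spectral_distr u) M = ennreal ((norm (F M u))\<^sup>2)"
proof -
  have Re: "Re (cinner u (F M u)) = inner u (F M u)" for M by (simp add: inner_ell2_def)
  have "countably_additive (sets borel) (\<lambda>M. ennreal (inner u (F M u)))"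
    unfolding countably_additive_def
  proof (intro allI impI)
    fix A :: "nat \<Rightarrow> real set"
    assume A: "range A \<subseteq> sets borel" "disjoint_family A" "\<Union> (range A) \<in> sets borel"
    have "(\<lambda>k. inner u (F (A k) u)) sums inner u (F (\<Union>k. A k) u)"
      by (rule bounded_linear.sums[OF bounded_linear_inner_right spectral_sums[OF A(1,2)]])
    moreover have "inner u (F (A k) u) \<ge> 0" for k
      using A by (subst inner_spectral) auto
    moreover have "inner u (F (\<Union>k. A k) u) \<ge> 0"
      using A by (subst inner_spectral) auto
    ultimately show "(\<Sum>k. ennreal (inner u (F (A k) u))) = ennreal (inner u (F (\<Union>k. A k) u))"
      by (intro sums_unique[symmetric]) simp
  qed
  moreover have "positive (sets borel) (\<lambda>M. ennreal (inner u (F M u)))"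
    by (simp add: positive_def spectral_empty)
  ultimately have "emeasure (spectral_distr u) M = ennreal (inner u (F M u))"
    using assms sets.sigma_algebra_axioms[of "borel :: real measure"]
    unfolding spectral_distr_def Re by (intro emeasure_measure_of_sigma) auto
  then show ?thesis using assms by (simp add: inner_spectral)
qed

lemma inner_spectral_integral: "inner u (T u) = (\<integral>x. x \<partial>spectral_distr u)"
  using spectral unfolding spectral_measure_def spectral_distr_def inner_ell2_def by simp

lemma finite_measure_spectral_distr: "finite_measure (spectral_distr u)"
  by (rule finite_measureI) (simp add: emeasure_spectral_distr)

lemma measure_spectral_distr_UNIV: "measure (spectral_distr u) UNIV = (norm u)\<^sup>2"
  by (simp add: measure_def emeasure_spectral_distr spectral_UNIV)

lemma AE_spectral_distr:
  assumes "M \<in> sets borel" "F M u = u"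
  shows "AE x in spectral_distr u. x \<in> M"
proof (rule AE_I)
  show "- M \<in> sets (spectral_distr u)" "{x \<in> space (spectral_distr u). x \<notin> M} \<subseteq> - M"
    using assms by auto
  have "F (- M) (F M u) = 0"
    by (rule spectral_disjoint) (use assms in auto)
  then show "emeasure (spectral_distr u) (- M) = 0"
    using assms by (simp add: emeasure_spectral_distr)
qed

lemma integrable_spectral_distr: "integrable (spectral_distr u) (\<lambda>x. x)"
proof -
  interpret finite_measure "spectral_distr u" by (rule finite_measure_spectral_distr)
  obtain a b where "\<And>u. F {a..b} u = u"
    using spectral unfolding spectral_measure_def by metis
  then have "AE x in spectral_distr u. x \<in> {a..b}"
    by (intro AE_spectral_distr) auto
  then have "AE x in spectral_distr u. norm x \<le> max \<bar>a\<bar> \<bar>b\<bar>"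
    by eventually_elim auto
  then show ?thesis by (intro integrable_const_bound) auto
qed

text \<open>This is how statements about \<open>T\<close> on a spectral subspace are reduced to the quadratic form
identity, the only link between \<open>T\<close> and its spectral measure in the definition.\<close>

lemma density_spectral_distr:
  assumes "A \<in> sets borel"
  shows "density (spectral_distr u) (indicator A) = spectral_distr (F A u)"
proof (rule measure_eqI)
  fix M assume "M \<in> sets (density (spectral_distr u) (indicator A))"
  then have M: "M \<in> sets borel" by simp
  then show "emeasure (density (spectral_distr u) (indicator A)) M = emeasure (spectral_distr (F A u)) M"
    using assms by (simp add: emeasure_density emeasure_spectral_distr spectral_Int Int_commute
        flip: indicator_inter_arith)
qed simp

lemma inner_spectral_part:
  assumes "A \<in> sets borel"
  shows "inner (F A u) (T (F A u)) = (\<integral>x. indicator A x * x \<partial>spectral_distr u)"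
proof -
  have "inner (F A u) (T (F A u)) = (\<integral>x. x \<partial>density (spectral_distr u) (\<lambda>x. ennreal (indicator A x)))"
    using assms by (simp add: inner_spectral_integral density_spectral_distr ennreal_indicator)
  also have "\<dots> = (\<integral>x. indicator A x * x \<partial>spectral_distr u)"
    using assms by (subst integral_density) auto
  finally show ?thesis .
qed

lemma inner_spectral_split:
  assumes "A \<in> sets borel"
  shows "inner u (T u) = inner (F A u) (T (F A u)) + inner (F (- A) u) (T (F (- A) u))"
proof -
  have cA: "- A \<in> sets borel" using assms by auto
  have int: "integrable (spectral_distr u) (\<lambda>x. indicator B x * x)" if "B \<in> sets borel" for B
    using integrable_mult_indicator[OF _ integrable_spectral_distr, of B u] that by simp
  have "inner u (T u) = (\<integral>x. indicator A x * x + indicator (- A) x * x \<partial>spectral_distr u)"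
    unfolding inner_spectral_integral by (intro Bochner_Integration.integral_cong) (auto simp: indicator_def)
  then show ?thesis
    using int[OF assms] int[OF cA] assms cA by (simp add: inner_spectral_part)
qed

lemma spectral_Compl: "A \<in> sets borel \<Longrightarrow> u = F A u + F (- A) u"
  using spectral_Un[of A "- A" u] by (simp add: spectral_UNIV)

text \<open>By the additivity of the quadratic form, the cross terms between complementary spectral
subspaces sum to zero; they are equal by the symmetry of \<open>T\<close>. This substitutes for the
commutation of \<open>T\<close> with its spectral projections.\<close>

lemma inner_spectral_reduces:
  assumes lin: "bounded_linear T" and sym: "\<And>u v. inner (T u) v = inner u (T v)"
    and A: "A \<in> sets borel"
  shows "inner (F A u) (T u) = inner (F A u) (T (F A u))"
proof -
  interpret bounded_linear T by (rule lin)
  define p q where "p = F A u" and "q = F (- A) u"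
  have u: "u = p + q" using spectral_Compl[OF A, of u] by (simp add: p_def q_def)
  have "inner (p + q) (T (p + q)) = inner p (T p) + inner q (T q)"
    using inner_spectral_split[OF A, of u] unfolding p_def[symmetric] q_def[symmetric] u[symmetric] .
  moreover have "inner q (T p) = inner p (T q)"
    using sym[of p q] by (simp add: inner_commute)
  ultimately have "inner p (T q) = 0" by (simp add: add inner_add)
  then have "inner p (T (p + q)) = inner p (T p)" by (simp add: add inner_add)
  then show ?thesis unfolding u[symmetric] by (simp add: p_def)
qed

lemma
  assumes M: "M \<in> sets borel" and u: "F M u = u"
  shows spectral_form_ge: "(\<And>x. x \<in> M \<Longrightarrow> c \<le> x) \<Longrightarrow> c * (norm u)\<^sup>2 \<le> inner u (T u)"
    and spectral_form_le: "(\<And>x. x \<in> M \<Longrightarrow> x \<le> c) \<Longrightarrow> inner u (T u) \<le> c * (norm u)\<^sup>2"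
proof -
  interpret finite_measure "spectral_distr u" by (rule finite_measure_spectral_distr)
  have const: "(\<integral>x. c \<partial>spectral_distr u) = c * (norm u)\<^sup>2"
    by (simp add: measure_spectral_distr_UNIV)
  note AE = AE_spectral_distr[OF M u]
  show "c * (norm u)\<^sup>2 \<le> inner u (T u)" if "\<And>x. x \<in> M \<Longrightarrow> c \<le> x"
    unfolding const[symmetric] inner_spectral_integral
    using AE that by (intro integral_mono_AE integrable_spectral_distr) auto
  show "inner u (T u) \<le> c * (norm u)\<^sup>2" if "\<And>x. x \<in> M \<Longrightarrow> x \<le> c"
    unfolding const[symmetric] inner_spectral_integral
    using AE that by (intro integral_mono_AE integrable_spectral_distr) auto
qed

text \<open>On the range of \<open>F A\<close> the form of \<open>T - E\<close> is bounded away from zero by \<open>\<delta>\<close>; the Cauchy-Schwarz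
inequality turns this into a bound for the component of an approximate eigenvector.\<close>

lemma norm_spectral_part_le:
  assumes lin: "bounded_linear T" and sym: "\<And>u v. inner (T u) v = inner u (T v)"
    and A: "A \<in> sets borel" and "\<delta> > 0"
    and away: "(\<forall>x\<in>A. E + \<delta> \<le> x) \<or> (\<forall>x\<in>A. x \<le> E - \<delta>)"
  shows "norm (F A u) \<le> norm (T u - E *\<^sub>R u) / \<delta>"
proof -
  define q where "q = F A u"
  have Fq: "F A q = q" using A by (simp add: q_def spectral_idem)
  have "inner q u = (norm q)\<^sup>2"
    using inner_spectral[OF A, of u] by (simp add: q_def inner_commute)
  then have form: "inner q (T u - E *\<^sub>R u) = inner q (T q) - E * (norm q)\<^sup>2"
    using inner_spectral_reduces[OF lin sym A, of u] by (simp add: q_def inner_diff_right)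
  have "\<delta> * (norm q)\<^sup>2 \<le> \<bar>inner q (T u - E *\<^sub>R u)\<bar>"
    using away
  proof
    assume "\<forall>x\<in>A. E + \<delta> \<le> x"
    then have "(E + \<delta>) * (norm q)\<^sup>2 \<le> inner q (T q)"
      by (intro spectral_form_ge[OF A Fq]) auto
    then show ?thesis unfolding form by (simp add: algebra_simps)
  next
    assume "\<forall>x\<in>A. x \<le> E - \<delta>"
    then have "inner q (T q) \<le> (E - \<delta>) * (norm q)\<^sup>2"
      by (intro spectral_form_le[OF A Fq]) auto
    then show ?thesis unfolding form by (simp add: algebra_simps)
  qed
  also have "\<dots> \<le> norm q * norm (T u - E *\<^sub>R u)" by (rule Cauchy_Schwarz_ineq2)
  finally have "norm q * (\<delta> * norm q) \<le> norm q * norm (T u - E *\<^sub>R u)"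
    by (simp add: power2_eq_square algebra_simps)
  then have "\<delta> * norm q \<le> norm (T u - E *\<^sub>R u)"
    by (cases "norm q = 0") (auto dest: mult_left_le_imp_le)
  then show ?thesis using \<open>\<delta> > 0\<close> by (simp add: q_def field_simps)
qed

lemma norm_spectral_defect_le:
  assumes lin: "bounded_linear T" and sym: "\<And>u v. inner (T u) v = inner u (T v)"
    and "a < E" "E < b"
  shows "norm (F {a<..<b} u - u) \<le> (1 / (E - a) + 1 / (b - E)) * norm (T u - E *\<^sub>R u)"
proof -
  have "- {a<..<b} = {..a} \<union> {b..}" by auto
  then have "F (- {a<..<b}) u = F {..a} u + F {b..} u"
    using spectral_Un[of "{..a}" "{b..}" u] assms(3,4) by fastforce
  then have "F {a<..<b} u - u = - (F {..a} u + F {b..} u)"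
    using spectral_Compl[of "{a<..<b}" u] by (simp add: algebra_simps) 
  then have "norm (F {a<..<b} u - u) \<le> norm (F {..a} u) + norm (F {b..} u)"
    by (simp add: norm_triangle_ineq norm_minus_commute del: minus_add_distrib)
  also have "norm (F {..a} u) \<le> norm (T u - E *\<^sub>R u) / (E - a)"
    using assms(3,4) by (intro norm_spectral_part_le lin sym) auto
  also have "norm (F {b..} u) \<le> norm (T u - E *\<^sub>R u) / (b - E)"
    using assms(3,4) by (intro norm_spectral_part_le lin sym) auto
  finally show ?thesis by (simp add: algebra_simps)
qed

end

section \<open>The commutator\<close>

text \<open>The commutator of \<open>Delta i\<close> with \<open>\<i>\<close> times the \<open>i\<close>-th conjugate operator. With
\<open>[S, N] = - S\<close> the position operators cancel, which leaves the product
\<open>(S\<^sup>k - S\<^sup>-\<^sup>k) (S - S\<^sup>-\<^sup>1) / (-4)\<close>, a bounded operator with symbol \<open>sin t sin (k t)\<close>.\<close>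

definition comm_part :: "'d::finite \<Rightarrow> nat \<Rightarrow> 'd ell2 \<Rightarrow> 'd ell2" where
  "comm_part i k u = (1/4) *\<^sub>R
     (shift i 1 (shift i (- int k) u - shift i (int k) u) - shift i (-1) (shift i (- int k) u - shift i (int k) u))"

definition comm_op :: "nat \<Rightarrow> 'd::finite ell2 \<Rightarrow> 'd ell2" where
  "comm_op k u = (\<Sum>i\<in>UNIV. Delta_prod (UNIV - {i}) (comm_part i k u))"

lemma fin_supp_add: "fin_supp u \<Longrightarrow> fin_supp v \<Longrightarrow> fin_supp (u + v)"
  unfolding fin_supp_def
  by (rule finite_subset[of _ "{n. seq u n \<noteq> 0} \<union> {n. seq v n \<noteq> 0}"]) (auto simp: seq_simps)

lemma fin_supp_shift: 
  assumes "fin_supp u" shows "fin_supp (shift i k u)"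
proof -
  have "{n. seq (shift i k u) n \<noteq> 0} \<subseteq> (\<lambda>n. n + axis i k) ` {n. seq u n \<noteq> 0}"
  proof
    fix n assume "n \<in> {n. seq (shift i k u) n \<noteq> 0}"
    then show "n \<in> (\<lambda>n. n + axis i k) ` {n. seq u n \<noteq> 0}"
      by (intro image_eqI[of _ _ "n - axis i k"]) (auto simp: seq_simps)
  qed
  then show ?thesis using assms unfolding fin_supp_def by (meson finite_imageI finite_subset)
qed

lemma fin_supp_Delta: "fin_supp u \<Longrightarrow> fin_supp (Delta i u)"
  by (simp add: Delta_def fin_supp_scaleR fin_supp_add fin_supp_shift)

lemma fin_supp_Delta_prod: "fin_supp u \<Longrightarrow> fin_supp (Delta_prod S u)"
  using finite[of S]
  by (induction S) (simp_all add: Delta_prod_empty Delta_prod_insert fin_supp_Delta)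

lemma seq_Delta: "seq (Delta i u) n = (seq u (n - axis i 1) + seq u (n + axis i 1)) / 2"
  by (simp add: Delta_def seq_simps axis_minus)

text \<open>A shift in another direction leaves the \<open>i\<close>-th coordinate unchanged, so it commutes with the
position operator.\<close>

lemma conj_op_Delta_other:
  assumes "fin_supp u" "l \<noteq> i"
  shows "conj_op i p \<kappa> (Delta l u) = Delta l (conj_op i p \<kappa> u)"
proof (rule ell2_eqI)
  fix n
  have l: "axis l (1::int) $ i = 0" using assms(2) by (simp add: axis_def)
  have c: "n - a - b = n - b - a" "n - a + b = n + b - a" "n + a + b = n + b + a" for a b :: "int ^ 'a"
    by (simp_all add: algebra_simps)
  define a b where "a = axis i (int (p * \<kappa>))" and "b = axis l (1 :: int)"
  show "seq (conj_op i p \<kappa> (Delta l u)) n = seq (Delta l (conj_op i p \<kappa> u)) n"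
    unfolding seq_conj_op[OF fin_supp_Delta[OF assms(1)]] seq_Delta seq_conj_op[OF assms(1)]
      shift_diff_seq_def pos_seq_def a_def[symmetric] b_def[symmetric]
    using l c[of a b] c[of b a] by (simp add: b_def[symmetric] field_simps)
qed

lemma conj_op_Delta_prod:
  assumes "fin_supp u" "i \<notin> S"
  shows "conj_op i p \<kappa> (Delta_prod S u) = Delta_prod S (conj_op i p \<kappa> u)"
  using finite[of S] assms(2)
proof (induction S)
  case (insert l S)
  then have "conj_op i p \<kappa> (Delta l (Delta_prod S u)) = Delta l (conj_op i p \<kappa> (Delta_prod S u))"
    by (intro conj_op_Delta_other fin_supp_Delta_prod assms(1)) auto
  with insert show ?case by (simp add: Delta_prod_insert)
qed (simp add: Delta_prod_empty)

lemma commutator_Delta_conj_op: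
  assumes "fin_supp u"
  shows "scaleC \<i> (Delta i (conj_op i p \<kappa> u) - conj_op i p \<kappa> (Delta i u)) = comm_part i (p * \<kappa>) u"
proof (rule ell2_eqI)
  fix n
  define a b where "a = axis i (int (p * \<kappa>))" and "b = axis i (1 :: int)"
  have c: "n - a - b = n - b - a" "n - a + b = n + b - a" "n + a - b = n - b + a" "n + a + b = n + b + a"
    by (simp_all add: algebra_simps)
  have b: "b $ i = 1" by (simp add: b_def)
  show "seq (scaleC \<i> (Delta i (conj_op i p \<kappa> u) - conj_op i p \<kappa> (Delta i u))) n
      = seq (comm_part i (p * \<kappa>) u) n"
    unfolding scaleC.rep_eq minus_ell2.rep_eq
      seq_conj_op[OF fin_supp_Delta[OF assms(1)]] seq_Delta seq_conj_op[OF assms(1)]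
      shift_diff_seq_def pos_seq_def comm_part_def scaleR_ell2.rep_eq shift.rep_eq axis_minus
      a_def[symmetric] b_def[symmetric] 
    using c by (simp add: b field_simps)
qed

lemma commutator_conj_sum_op:
  fixes u :: "'d::finite ell2"
  assumes u: "fin_supp u"
  shows "scaleC \<i> (mv_laplacian (conj_sum_op p \<kappa> u) - conj_sum_op p \<kappa> (mv_laplacian u)) = comm_op (p * \<kappa>) u"
proof -
  interpret D: bounded_linear "mv_laplacian :: 'd ell2 \<Rightarrow> 'd ell2"
    using bounded_clinear_Delta_prod[of "UNIV :: 'd set"] by (simp add: mv_laplacian_eq bounded_clinear_def)
  interpret I: bounded_linear "scaleC \<i> :: 'd ell2 \<Rightarrow> 'd ell2" by (rule bounded_linear_scaleC)
  have "scaleC \<i> (mv_laplacian (conj_op i p \<kappa> u) - conj_op i p \<kappa> (mv_laplacian u))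
      = Delta_prod (UNIV - {i}) (comm_part i (p * \<kappa>) u)" for i
  proof -
    interpret P: bounded_linear "Delta_prod (UNIV - {i}) :: 'd ell2 \<Rightarrow> 'd ell2"
      using bounded_clinear_Delta_prod[of "UNIV - {i}"] by (simp add: bounded_clinear_def)
    have "mv_laplacian (conj_op i p \<kappa> u) = Delta_prod (UNIV - {i}) (Delta i (conj_op i p \<kappa> u))"
      by (simp add: mv_laplacian_split[of _ i] Delta_prod_Delta)
    moreover have "conj_op i p \<kappa> (mv_laplacian u) = Delta_prod (UNIV - {i}) (conj_op i p \<kappa> (Delta i u))"
      by (simp add: mv_laplacian_split[of _ i] conj_op_Delta_prod u fin_supp_Delta flip: Delta_prod_Delta)
    moreover have "scaleC \<i> (Delta_prod (UNIV - {i}) v) = Delta_prod (UNIV - {i}) (scaleC \<i> v)" for v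
      using bounded_clinear_Delta_prod[of "UNIV - {i}"] by (simp add: bounded_clinear_def)
    ultimately show ?thesis
      by (simp add: commutator_Delta_conj_op[OF u] flip: P.diff)
  qed
  then show ?thesis
    by (simp add: conj_sum_op_def comm_op_def D.sum I.sum flip: sum_subtractf)
qed

text \<open>The bound is uniform in \<open>k\<close>, as is needed to exchange the sum over \<open>k\<close> with the limit of wave
packets.\<close>

lemma norm_comm_op_le: "norm (comm_op k u :: 'd::finite ell2) \<le> real CARD('d) * norm u"
proof -
  have part: "norm (comm_part i k u) \<le> norm u" for i
  proof -
    define w where "w = shift i (- int k) u - shift i (int k) u"
    have "norm w \<le> norm u + norm u"
      using norm_triangle_ineq4[of "shift i (- int k) u" "shift i (int k) u"] by (simp add: norm_shift w_def)
    moreover have "norm (shift i 1 w - shift i (-1) w) \<le> norm w + norm w"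
      using norm_triangle_ineq4[of "shift i 1 w" "shift i (-1) w"] by (simp add: norm_shift)
    ultimately show ?thesis by (simp add: comm_part_def w_def[symmetric])
  qed
  have "norm (comm_op k u) \<le> (\<Sum>i\<in>(UNIV :: 'd set). norm u)"
    unfolding comm_op_def
    by (intro sum_norm_le) (metis norm_Delta_prod_le part order_trans)
  then show ?thesis by simp
qed

section \<open>Symbols of the commutators\<close>

lemma approx_eigen_sum:
  fixes v :: "nat \<Rightarrow> 'd::finite ell2"
  assumes "finite I" "\<And>i. i \<in> I \<Longrightarrow> approx_eigen v (T i) (z i)"
  shows "approx_eigen v (\<lambda>u. \<Sum>i\<in>I. T i u) (\<Sum>i\<in>I. z i)"
  using assms
proof (induction I)
  case empty
  have "scaleC 0 u = 0" for u :: "'d ell2" by (rule ell2_eqI) (simp add: seq_simps)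
  then show ?case by (simp add: approx_eigen_def)
qed (simp add: approx_eigen_add)

lemma approx_eigen_diff:
  assumes "approx_eigen v S z" "approx_eigen v T w"
  shows "approx_eigen v (\<lambda>u. S u - T u) (z - w)"
proof -
  have "approx_eigen v (\<lambda>u. S u + scaleC (- 1) (T u)) (z + (- 1) * w)"
    by (intro approx_eigen_add approx_eigen_scaleC assms)
  moreover have "S u + scaleC (- 1) (T u) = S u - T u" for u
    by (rule ell2_eqI) (simp add: seq_simps)
  ultimately show ?thesis by simp
qed

lemma cheb_U_mult_sin_squared:
  assumes "k \<ge> 1"
  shows "(1 - (cos t)\<^sup>2) * cheb_U (k - 1) (cos t) = sin t * sin (real k * t)"
proof -
  have "1 - (cos t)\<^sup>2 = sin t * sin t"
    using sin_squared_eq[of t] by (simp add: power2_eq_square)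
  then show ?thesis using cheb_U_sin[of t "k - 1"] assms by (simp add: mult.assoc)
qed

lemma approx_eigen_comm_part:
  "approx_eigen (wave_packet \<theta>) (comm_part i k) (of_real (sin (\<theta> $ i) * sin (real k * \<theta> $ i)))"
proof -
  let ?w = "wave_packet \<theta>" and ?S = "\<lambda>u. shift i (- int k) u - shift i (int k) u"
  have cl: "bounded_clinear (shift i m)" for m by (rule bounded_clinear_shift)
  have "approx_eigen ?w (\<lambda>u. scaleC (1/4) (shift i 1 (?S u) - shift i (-1) (?S u)))
      (1/4 * (cis (- of_int 1 * \<theta> $ i) * (cis (- of_int (- int k) * \<theta> $ i) - cis (- of_int (int k) * \<theta> $ i))
       - cis (- of_int (-1) * \<theta> $ i) * (cis (- of_int (- int k) * \<theta> $ i) - cis (- of_int (int k) * \<theta> $ i))))"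
    by (intro approx_eigen_scaleC approx_eigen_diff approx_eigen_compose[OF cl] approx_eigen_wave_packet_shift)
  moreover have "scaleC (1/4) u = (1/4) *\<^sub>R u" for u :: "'a ell2"
    using scaleC_of_real[of "1/4" u] by simp
  moreover have "1/4 * (cis (- of_int 1 * \<theta> $ i) * (cis (- of_int (- int k) * \<theta> $ i) - cis (- of_int (int k) * \<theta> $ i))
       - cis (- of_int (-1) * \<theta> $ i) * (cis (- of_int (- int k) * \<theta> $ i) - cis (- of_int (int k) * \<theta> $ i)))
      = complex_of_real (sin (\<theta> $ i) * sin (real k * \<theta> $ i))"
    by (simp add: complex_eq_iff field_simps)
  ultimately show ?thesis by (simp add: comm_part_def[abs_def])
qed

lemma approx_eigen_comm_op:
  assumes "k \<ge> 1"
  shows "approx_eigen (wave_packet \<theta>) (comm_op k) (of_real (g_fun k (\<chi> l. cos (\<theta> $ l))))"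
proof -
  have "approx_eigen (wave_packet \<theta>) (\<lambda>u. \<Sum>i\<in>UNIV. Delta_prod (UNIV - {i}) (comm_part i k u))
      (\<Sum>i\<in>UNIV. of_real (\<Prod>l\<in>UNIV - {i}. cos (\<theta> $ l)) * of_real (sin (\<theta> $ i) * sin (real k * \<theta> $ i)))"
    by (intro approx_eigen_sum approx_eigen_compose bounded_clinear_Delta_prod
        approx_eigen_Delta_prod approx_eigen_comm_part) simp
  moreover have "(\<Sum>i\<in>UNIV. of_real (\<Prod>l\<in>UNIV - {i}. cos (\<theta> $ l)) * of_real (sin (\<theta> $ i) * sin (real k * \<theta> $ i)))
     = complex_of_real (g_fun k (\<chi> l. cos (\<theta> $ l)))"
    unfolding g_fun_def
    by (simp only: mult.assoc vec_lambda_inverse UNIV_I cheb_U_mult_sin_squared[OF assms] of_real_mult of_real_sum)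
  ultimately show ?thesis by (simp add: comm_op_def[abs_def])
qed

lemma approx_eigen_inner:
  assumes "approx_eigen v T (of_real r)" "\<And>N. norm (v N) = 1"
  shows "(\<lambda>N. inner (v N) (T (v N))) \<longlonglongrightarrow> r"
proof -
  have *: "(\<lambda>N. norm (T (v N) - r *\<^sub>R v N)) \<longlonglongrightarrow> 0"
    using assms(1) by (simp add: approx_eigen_def scaleC_of_real tendsto_norm_zero_iff)
  have "(\<lambda>N. inner (v N) (T (v N) - r *\<^sub>R v N)) \<longlonglongrightarrow> 0"
  proof (rule Lim_null_comparison[OF _ *], rule always_eventually, rule allI)
    fix N show "norm (inner (v N) (T (v N) - r *\<^sub>R v N)) \<le> norm (T (v N) - r *\<^sub>R v N)"
      using Cauchy_Schwarz_ineq2[of "v N" "T (v N) - r *\<^sub>R v N"] assms(2)[of N] by simp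
  qed
  moreover have "inner (v N) (T (v N) - r *\<^sub>R v N) = inner (v N) (T (v N)) - r" for N
    using assms(2)[of N] by (simp add: inner_diff_right flip: power2_norm_eq_inner)
  ultimately show ?thesis by (simp add: LIM_zero_iff)
qed

section \<open>Coefficients of a self-adjoint combination\<close>

definition origin_seq :: "'d::finite ell2" where
  "origin_seq = Abs_ell2 (\<lambda>n. of_bool (n = 0))"

lemma seq_origin_seq: "seq origin_seq n = of_bool (n = 0)"
proof -
  have "(\<lambda>n. (cmod (of_bool (n = 0)))\<^sup>2) summable_on (UNIV :: (int ^ 'a) set)"
    by (rule finite_nonzero_values_imp_summable_on) (auto intro: finite_subset[of _ "{0}"])
  then show ?thesis by (simp add: origin_seq_def Abs_ell2_inverse)
qed

lemma fin_supp_origin_seq: "fin_supp origin_seq"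
  by (simp add: fin_supp_def seq_origin_seq)

lemma axis_int_eq_iff: "axis i (a::int) = axis j b \<longleftrightarrow> a = 0 \<and> b = 0 \<or> i = j \<and> a = b"
  by (auto simp: axis_eq_axis axis_def vec_eq_iff)

lemma seq_conj_sum_op_origin:
  fixes i0 :: "'d::finite"
  assumes "p \<ge> 1" "q \<ge> 1" "\<kappa> \<ge> 1"
  shows "seq (conj_sum_op p \<kappa> (origin_seq :: 'd ell2)) (axis i0 (int (q * \<kappa>)))
    = (if p = q then of_nat (p * \<kappa>) / (4 * \<i>) else 0)"
proof -
  let ?n = "axis i0 (int (q * \<kappa>)) :: int ^ 'd"
  have seq_sum: "seq (\<Sum>i\<in>I. w i) n = (\<Sum>i\<in>I. seq (w i) n)" if "finite I" for I :: "'d set" and w n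
    using that by (induction I) (simp_all add: seq_simps)
  have pos: "pos_seq i (seq origin_seq) = (\<lambda>n. 0)" for i :: 'd
  proof
    fix n show "pos_seq i (seq origin_seq) n = 0"
      by (cases "n = 0") (simp_all add: pos_seq_def seq_origin_seq)
  qed
  have "seq (conj_op i p \<kappa> (origin_seq :: 'd ell2)) ?n
      = (if i = i0 then (if p = q then of_nat (p * \<kappa>) / (4 * \<i>) else 0) else 0)" for i
  proof -
    have m: "?n - axis i (int (p * \<kappa>)) = 0 \<longleftrightarrow> i = i0 \<and> p = q"
      using assms axis_int_eq_iff[of i0 "int (q * \<kappa>)" i "int (p * \<kappa>)"] by (auto simp flip: of_nat_mult)
    have p: "?n + axis i (int (p * \<kappa>)) = 0 \<longleftrightarrow> False"
    proof -
      have "?n + axis i (int (p * \<kappa>)) = 0 \<longleftrightarrow> ?n = axis i (- int (p * \<kappa>))"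
        by (simp add: axis_minus eq_neg_iff_add_eq_0)
      moreover have "int (q * \<kappa>) > 0" "int (p * \<kappa>) > 0" using assms by simp_all
      then have "int (q * \<kappa>) \<noteq> 0" "int (q * \<kappa>) \<noteq> - int (p * \<kappa>)" by linarith+
      ultimately show ?thesis
        using axis_int_eq_iff[of i0 "int (q * \<kappa>)" i "- int (p * \<kappa>)"] by blast
    qed
    show ?thesis
      unfolding seq_conj_op[OF fin_supp_origin_seq] pos shift_diff_seq_def
      unfolding pos_seq_def seq_origin_seq m p by simp
  qed
  then show ?thesis by (simp add: conj_sum_op_def seq_sum)
qed

text \<open>The image of the origin vector under the combination has, at the point at distance \<open>p \<kappa>\<close> from
the origin on a coordinate axis, a coordinate of modulus \<open>\<bar>\<rho> p\<bar> p \<kappa> / 4\<close>. Thus \<open>p \<rho> p\<close> is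
square summable, and \<open>2 \<bar>\<rho> p\<bar> \<le> (p \<rho> p)\<^sup>2 + 1 / p\<^sup>2\<close>.\<close>

lemma self_adjoint_comb_summable:
  assumes comb: "self_adjoint_comb TYPE('d::finite) \<rho> \<kappa>" and \<kappa>: "\<kappa> \<ge> 1"
  shows "summable (\<lambda>k. \<bar>\<rho> (Suc k)\<bar>)"
proof -
  obtain i0 :: 'd where True by simp
  define v where "v = lin_comb \<rho> \<kappa> (origin_seq :: 'd ell2)"
  define pt where "pt k = (axis i0 (int (Suc k * \<kappa>)) :: int ^ 'd)" for k
  have "summable (\<lambda>k. \<rho> (Suc k) *\<^sub>R conj_sum_op (Suc k) \<kappa> (origin_seq :: 'd ell2))"
    using comb fin_supp_origin_seq unfolding self_adjoint_comb_def by blast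
  then have sums: "(\<lambda>k. \<rho> (Suc k) *\<^sub>R conj_sum_op (Suc k) \<kappa> origin_seq) sums v"
    unfolding v_def lin_comb_def by (rule summable_sums)
  have coord: "seq v (pt q) = of_real (\<rho> (Suc q)) * (of_nat (Suc q * \<kappa>) / (4 * \<i>))" for q
  proof -
    have "(\<lambda>k. seq (\<rho> (Suc k) *\<^sub>R conj_sum_op (Suc k) \<kappa> origin_seq) (pt q)) sums seq v (pt q)"
      by (rule bounded_linear.sums[OF bounded_linear_seq sums])
    moreover have "seq (\<rho> (Suc k) *\<^sub>R conj_sum_op (Suc k) \<kappa> origin_seq) (pt q)
        = (if k = q then of_real (\<rho> (Suc q)) * (of_nat (Suc q * \<kappa>) / (4 * \<i>)) else 0)" for k
      using seq_conj_sum_op_origin[of "Suc k" "Suc q" \<kappa> i0] \<kappa> by (simp add: seq_simps pt_def)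
    moreover have "(\<lambda>k. if k = q then of_real (\<rho> (Suc q)) * (of_nat (Suc q * \<kappa>) / (4 * \<i>)) else 0) sums
       (of_real (\<rho> (Suc q)) * (of_nat (Suc q * \<kappa>) / (4 * \<i>)))"
      by (rule sums_single)
    ultimately show ?thesis using sums_unique2 by fastforce
  qed
  have inj: "inj pt" using \<kappa> unfolding inj_def pt_def axis_int_eq_iff
    by (auto simp del: of_nat_mult of_nat_Suc)
  have "(\<lambda>n. (cmod (seq v n))\<^sup>2) summable_on range pt"
    by (rule summable_on_subset[OF seq_summable]) simp
  then have "(\<lambda>k. (cmod (seq v (pt k)))\<^sup>2) summable_on UNIV"
    using summable_on_reindex[OF inj, of "\<lambda>n. (cmod (seq v n))\<^sup>2"] by (simp add: comp_def)
  then have "summable (\<lambda>k. (cmod (seq v (pt k)))\<^sup>2)"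
    by (rule summable_on_imp_summable)
  then have "summable (\<lambda>k. 8 * (cmod (seq v (pt k)))\<^sup>2 + 1 / 2 * (1 / real (Suc k) ^ 2))"
    by (intro summable_add summable_mult) (use inverse_squares_sums in \<open>auto simp: sums_iff add.commute\<close>)
  then show ?thesis
  proof (rule summable_comparison_test')
    fix k
    define s where "s = real (Suc k)"
    have s: "s > 0" by (simp add: s_def)
    have "8 * (cmod (seq v (pt k)))\<^sup>2 = 1 / 2 * (\<bar>\<rho> (Suc k)\<bar> * s * real \<kappa>)\<^sup>2"
      unfolding coord norm_mult norm_divide norm_of_nat norm_of_real
      by (simp add: power_divide power_mult_distrib s_def mult_ac del: of_nat_Suc mult_Suc mult_Suc_right)
    also have "\<dots> \<ge> 1 / 2 * (\<bar>\<rho> (Suc k)\<bar> * s)\<^sup>2"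
    proof -
      have "\<bar>\<rho> (Suc k)\<bar> * s * 1 \<le> \<bar>\<rho> (Suc k)\<bar> * s * real \<kappa>"
        using \<kappa> s by (intro mult_left_mono) auto
      then show ?thesis using s by (simp add: power_mono)
    qed
    finally have A: "8 * (cmod (seq v (pt k)))\<^sup>2 \<ge> 1 / 2 * (\<bar>\<rho> (Suc k)\<bar> * s)\<^sup>2" .
    have "2 * \<bar>\<rho> (Suc k)\<bar> = 2 * (\<bar>\<rho> (Suc k)\<bar> * s) * (1 / s)" using s by simp
    also have "\<dots> \<le> (\<bar>\<rho> (Suc k)\<bar> * s)\<^sup>2 + (1 / s)\<^sup>2"
      by (rule sum_squares_bound)
    finally show "norm \<bar>\<rho> (Suc k)\<bar> \<le> 8 * (cmod (seq v (pt k)))\<^sup>2 + 1 / 2 * (1 / real (Suc k) ^ 2)"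
      using A by (simp add: s_def power_divide)
  qed
qed

section \<open>Cone relations produce thresholds\<close>

lemma energy_surface_angles:
  fixes x :: "real ^ 'd::finite"
  assumes "x \<in> energy_surface E"
  obtains \<theta> where "x = (\<chi> l. cos (\<theta> $ l))" "(\<Prod>l\<in>UNIV. cos (\<theta> $ l)) = E"
proof
  show "x = (\<chi> l. cos ((\<chi> l. arccos (x $ l)) $ l))"
    using assms by (auto simp: energy_surface_def vec_eq_iff)
  have "cos (arccos (x $ l)) = x $ l" for l using assms by (auto simp: energy_surface_def)
  then show "(\<Prod>l\<in>UNIV. cos ((\<chi> l. arccos (x $ l)) $ l)) = E"
    using assms by (simp add: energy_surface_def)
qed

lemma mv_laplacian_wave_packet:
  assumes "(\<Prod>l\<in>UNIV. cos (\<theta> $ l)) = E"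
  shows "(\<lambda>N. norm (mv_laplacian (wave_packet \<theta> N) - E *\<^sub>R wave_packet \<theta> N)) \<longlonglongrightarrow> 0"
  using approx_eigen_Delta_prod[of \<theta> UNIV]
  unfolding assms approx_eigen_def mv_laplacian_eq scaleC_of_real by (rule tendsto_norm_zero)

text \<open>A bounded inverse of \<open>D - E\<close> would send the null sequence \<open>(D - E) v N\<close> to the unit vectors
\<open>v N\<close>.\<close>

lemma energy_in_spectrum:
  assumes "x \<in> (energy_surface E :: (real ^ 'd::finite) set)"
  shows "complex_of_real E \<in> spectrum (mv_laplacian :: 'd ell2 \<Rightarrow> 'd ell2)"
proof -
  obtain \<theta> :: "real ^ 'd" where \<theta>: "(\<Prod>l\<in>UNIV. cos (\<theta> $ l)) = E"
    using energy_surface_angles[OF assms] by metis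
  have False if R: "bounded_clinear R" "\<And>u. R (mv_laplacian u - scaleC (of_real E) u) = u"
    for R :: "'d ell2 \<Rightarrow> 'd ell2"
  proof -
    interpret bounded_linear R using R by (simp add: bounded_clinear_def)
    have "(\<lambda>N. R (mv_laplacian (wave_packet \<theta> N) - E *\<^sub>R wave_packet \<theta> N)) \<longlonglongrightarrow> 0"
      using mv_laplacian_wave_packet[OF \<theta>] by (intro tendsto_zero) (simp add: tendsto_norm_zero_iff)
    then have "(\<lambda>N. norm (wave_packet \<theta> N)) \<longlonglongrightarrow> 0"
      using R(2) by (simp add: scaleC_of_real tendsto_norm_zero_iff)
    then show False by (simp add: norm_wave_packet LIMSEQ_const_iff)
  qed
  then show ?thesis unfolding spectrum_def by blast
qed

text \<open>Finitely supported vectors stay so under the Laplacian, so the series of the combination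
converges on both sides of the commutator and may be commuted with the bounded operator \<open>D\<close>.\<close>

lemma inner_commutator_ext:
  fixes B :: "'d::finite ell2 \<Rightarrow> 'd ell2"
  assumes comb: "self_adjoint_comb TYPE('d) \<rho> \<kappa>" and B: "commutator_ext \<rho> \<kappa> B" and u: "fin_supp u"
  shows "(\<lambda>k. \<rho> (Suc k) * inner w (comm_op (Suc k * \<kappa>) u)) sums inner w (B u)"
proof -
  interpret D: bounded_linear "mv_laplacian :: 'd ell2 \<Rightarrow> 'd ell2"
    using bounded_clinear_Delta_prod[of "UNIV :: 'd set"] by (simp add: mv_laplacian_eq bounded_clinear_def)
  let ?A = "\<lambda>k u :: 'd ell2. \<rho> (Suc k) *\<^sub>R conj_sum_op (Suc k) \<kappa> u"
  have sums: "(\<lambda>k. ?A k v) sums lin_comb \<rho> \<kappa> v" if "fin_supp v" for v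
    using comb that unfolding self_adjoint_comb_def lin_comb_def by (blast intro: summable_sums)
  have Du: "fin_supp (mv_laplacian u)" by (simp add: mv_laplacian_eq fin_supp_Delta_prod u)
  have "(\<lambda>k. scaleC \<i> (mv_laplacian (?A k u) - ?A k (mv_laplacian u))) sums
      scaleC \<i> (mv_laplacian (lin_comb \<rho> \<kappa> u) - lin_comb \<rho> \<kappa> (mv_laplacian u))"
    by (intro bounded_linear.sums[OF bounded_linear_scaleC] sums_diff D.sums sums u Du)
  moreover have "scaleC \<i> (mv_laplacian (?A k u) - ?A k (mv_laplacian u))
      = \<rho> (Suc k) *\<^sub>R comm_op (Suc k * \<kappa>) u" for k
  proof -
    interpret I: bounded_linear "scaleC \<i> :: 'd ell2 \<Rightarrow> 'd ell2" by (rule bounded_linear_scaleC)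
    show ?thesis
      unfolding commutator_conj_sum_op[OF u, symmetric] D.scaleR scaleR_diff_right[symmetric] I.scaleR ..
  qed
  ultimately have "(\<lambda>k. \<rho> (Suc k) *\<^sub>R comm_op (Suc k * \<kappa>) u) sums B u"
    using B u by (simp add: commutator_ext_def)
  from bounded_linear.sums[OF bounded_linear_inner_right this] show ?thesis by simp
qed

lemma tendsto_inner_bounded_null:
  assumes "r \<longlonglongrightarrow> 0" "\<And>N. norm (w N) \<le> K"
  shows "(\<lambda>N. inner (w N) (r N)) \<longlonglongrightarrow> 0"
proof (rule Lim_null_comparison)
  show "\<forall>\<^sub>F N in sequentially. norm (inner (w N) (r N)) \<le> K * norm (r N)"
  proof (intro always_eventually allI)
    fix N
    have "\<bar>inner (w N) (r N)\<bar> \<le> norm (w N) * norm (r N)" by (rule Cauchy_Schwarz_ineq2)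
    also have "\<dots> \<le> K * norm (r N)" by (intro mult_right_mono assms) simp
    finally show "norm (inner (w N) (r N)) \<le> K * norm (r N)" by simp
  qed
  show "(\<lambda>N. K * norm (r N)) \<longlonglongrightarrow> 0"
    by (intro tendsto_mult_right_zero tendsto_norm_zero assms)
qed

text \<open>Wave packets \<open>v N\<close> at the frequency of \<open>x\<close> satisfy \<open>P (v N) - v N \<longlonglongrightarrow> 0\<close>, so the two sides of
the estimate converge to the symbol of the commutator at \<open>x\<close> and to \<open>\<gamma>\<close>.\<close>

lemma mourre_estimate_on_energy_surface:
  fixes B P :: "'d::finite ell2 \<Rightarrow> 'd ell2" and x :: "real ^ 'd"
  assumes \<kappa>: "\<kappa> \<ge> 1"
    and comb: "self_adjoint_comb TYPE('d) \<rho> \<kappa>" and B: "commutator_ext \<rho> \<kappa> B"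
    and ab: "a < E" "E < b" and P: "spectral_projection mv_laplacian {a<..<b} P"
    and mourre: "\<And>u. inner u (P (B (P u))) \<ge> \<gamma> * inner u (P u)"
    and x: "x \<in> energy_surface E"
  shows "summable (\<lambda>k. \<rho> (Suc k) * g_fun (Suc k * \<kappa>) x)"
    and "\<gamma> \<le> (\<Sum>k. \<rho> (Suc k) * g_fun (Suc k * \<kappa>) x)"
proof -
  obtain \<theta> where x_eq: "x = (\<chi> l. cos (\<theta> $ l))" and \<theta>: "(\<Prod>l\<in>UNIV. cos (\<theta> $ l)) = E"
    using energy_surface_angles[OF x] by metis
  define v where "v = wave_packet \<theta>"
  have v: "norm (v N) = 1" "fin_supp (v N)" for N
    by (simp_all add: v_def norm_wave_packet fin_supp_wave_packet)
  obtain F where F: "spectral_measure mv_laplacian F" and PF: "P = F {a<..<b}"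
    using P unfolding spectral_projection_def by blast
  interpret B: bounded_linear B using B by (simp add: commutator_ext_def bounded_clinear_def)
  have lin: "bounded_linear (mv_laplacian :: 'd ell2 \<Rightarrow> 'd ell2)"
    using bounded_clinear_Delta_prod[of "UNIV :: 'd set"] by (simp add: mv_laplacian_eq bounded_clinear_def)
  have sym: "inner (mv_laplacian u) w = inner u (mv_laplacian w)" for u w :: "'d ell2"
    by (simp add: mv_laplacian_eq inner_Delta_prod)
  define r where "r N = P (v N) - v N" for N
  have r: "r \<longlonglongrightarrow> 0"
  proof (rule Lim_null_comparison)
    show "\<forall>\<^sub>F N in sequentially. norm (r N)
        \<le> (1 / (E - a) + 1 / (b - E)) * norm (mv_laplacian (v N) - E *\<^sub>R v N)"
      unfolding r_def PF by (intro always_eventually allI norm_spectral_defect_le[OF F lin sym ab])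
    show "(\<lambda>N. (1 / (E - a) + 1 / (b - E)) * norm (mv_laplacian (v N) - E *\<^sub>R v N)) \<longlonglongrightarrow> 0"
      unfolding v_def by (rule tendsto_mult_right_zero[OF mv_laplacian_wave_packet[OF \<theta>]])
  qed

  \<comment> \<open>A summable majorant, uniform in the packet, for the termwise limit of the symbol series.\<close>
  define M where "M k = \<bar>\<rho> (Suc k)\<bar> * real CARD('d)" for k
  have tannery: "(\<forall>\<^sub>F N in sequentially. summable (\<lambda>k. norm (\<rho> (Suc k) * inner (v N) (comm_op (Suc k * \<kappa>) (v N))))) \<and>
      summable (\<lambda>k. norm (\<rho> (Suc k) * g_fun (Suc k * \<kappa>) x)) \<and>
      (\<lambda>N. \<Sum>k. \<rho> (Suc k) * inner (v N) (comm_op (Suc k * \<kappa>) (v N)))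
        \<longlonglongrightarrow> (\<Sum>k. \<rho> (Suc k) * g_fun (Suc k * \<kappa>) x)"
  proof (rule tannerys_theorem)
    show "(\<lambda>N. \<rho> (Suc k) * inner (v N) (comm_op (Suc k * \<kappa>) (v N)))
        \<longlonglongrightarrow> \<rho> (Suc k) * g_fun (Suc k * \<kappa>) x" for k
    proof (intro tendsto_mult_left approx_eigen_inner v(1))
      have "Suc k * \<kappa> \<ge> 1" using \<kappa> by simp
      then show "approx_eigen v (comm_op (Suc k * \<kappa>)) (of_real (g_fun (Suc k * \<kappa>) x))"
        unfolding v_def x_eq by (rule approx_eigen_comm_op)
    qed
    have "norm (\<rho> (Suc k) * inner (v N) (comm_op (Suc k * \<kappa>) (v N))) \<le> M k" for k N
    proof -
      have "\<bar>inner (v N) (comm_op (Suc k * \<kappa>) (v N))\<bar> \<le> norm (v N) * norm (comm_op (Suc k * \<kappa>) (v N))"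
        by (rule Cauchy_Schwarz_ineq2)
      also have "\<dots> \<le> real CARD('d)"
        using norm_comm_op_le[of "Suc k * \<kappa>" "v N"] v(1) by simp
      finally show ?thesis unfolding M_def by (simp add: abs_mult mult_left_mono)
    qed
    then show "\<forall>\<^sub>F (k, N) in sequentially \<times>\<^sub>F sequentially.
        norm (\<rho> (Suc k) * inner (v N) (comm_op (Suc k * \<kappa>) (v N))) \<le> M k"
      by (intro always_eventually) auto
    show "summable M"
      unfolding M_def by (intro summable_mult2 self_adjoint_comb_summable[OF comb \<kappa>])
  qed simp
  show "summable (\<lambda>k. \<rho> (Suc k) * g_fun (Suc k * \<kappa>) x)"
    by (rule summable_norm_cancel[OF tannery[THEN conjunct2, THEN conjunct1]])
  have limB: "(\<lambda>N. inner (v N) (B (v N))) \<longlonglongrightarrow> (\<Sum>k. \<rho> (Suc k) * g_fun (Suc k * \<kappa>) x)"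
    unfolding sums_unique[OF inner_commutator_ext[OF comb B v(2)]]
    by (rule tannery[THEN conjunct2, THEN conjunct2])

  \<comment> \<open>Replacing \<open>v N\<close> by \<open>P (v N) = v N + r N\<close> in the form of \<open>B\<close> changes it by terms containing \<open>r N\<close>.\<close>
  obtain K where "\<And>u. norm (B u) \<le> norm u * K" using B.bounded by blast
  then have Bv: "norm (B (v N)) \<le> K" for N using v(1)[of N] by (metis mult_1)
  have "(\<lambda>N. inner (v N) (B (r N)) + inner (B (v N)) (r N) + inner (r N) (B (r N))) \<longlonglongrightarrow> 0 + 0 + inner 0 (B 0)"
  proof (intro tendsto_add)
    show "(\<lambda>N. inner (v N) (B (r N))) \<longlonglongrightarrow> 0"
      by (rule tendsto_inner_bounded_null[OF B.tendsto_zero[OF r], of _ 1]) (simp add: v)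
    show "(\<lambda>N. inner (B (v N)) (r N)) \<longlonglongrightarrow> 0"
      by (rule tendsto_inner_bounded_null[OF r Bv])
    show "(\<lambda>N. inner (r N) (B (r N))) \<longlonglongrightarrow> inner 0 (B 0)"
      by (intro tendsto_inner B.tendsto r)
  qed
  from tendsto_add[OF limB this]
  have lim: "(\<lambda>N. inner (P (v N)) (B (P (v N)))) \<longlonglongrightarrow> (\<Sum>k. \<rho> (Suc k) * g_fun (Suc k * \<kappa>) x)"
    by (simp add: r_def B.diff B.zero inner_diff inner_commute)
  have "(\<lambda>N. inner (v N) (r N)) \<longlonglongrightarrow> 0"
    by (rule tendsto_inner_bounded_null[OF r, of _ 1]) (simp add: v)
  then have "(\<lambda>N. \<gamma> * (1 + inner (v N) (r N))) \<longlonglongrightarrow> \<gamma> * (1 + 0)"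
    by (intro tendsto_intros)
  moreover have "\<gamma> * (1 + inner (v N) (r N)) \<le> inner (P (v N)) (B (P (v N)))" for N
  proof -
    have "inner (v N) (P (v N)) = 1 + inner (v N) (r N)"
      using v(1)[of N] by (simp add: r_def inner_diff_right flip: power2_norm_eq_inner)
    moreover have "inner (v N) (P (B (P (v N)))) = inner (P (v N)) (B (P (v N)))"
      unfolding PF by (subst spectral_symmetric[OF F]) auto
    ultimately show ?thesis using mourre[of "v N"] by simp
  qed
  ultimately show "\<gamma> \<le> (\<Sum>k. \<rho> (Suc k) * g_fun (Suc k * \<kappa>) x)"
    using LIMSEQ_le[OF _ lim] by auto
qed

text \<open>The symbol \<open>G\<close> of the commutator would be positive at all points of the energy surface, and
at \<open>x m\<close> it would be a combination of positive values with nonpositive coefficients.\<close>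

theorem threshold_set_m_subset_threshold_set:
  assumes \<kappa>: "\<kappa> \<ge> 1"
  shows "threshold_set_m TYPE('d::finite) m \<kappa> \<subseteq> threshold_set TYPE('d) \<kappa>"
proof
  fix E assume "E \<in> threshold_set_m TYPE('d) m \<kappa>"
  then obtain x :: "nat \<Rightarrow> real ^ 'd" and \<omega> where
    x: "\<And>q. q \<le> m \<Longrightarrow> x q \<in> energy_surface E" and \<omega>: "\<And>q. q < m \<Longrightarrow> \<omega> q \<le> 0"
    and comb: "\<And>p. p \<ge> 1 \<Longrightarrow> g_fun (p * \<kappa>) (x m) = (\<Sum>q<m. \<omega> q * g_fun (p * \<kappa>) (x q))"
    unfolding threshold_set_m_def by blast
  have "E \<notin> mourre_set TYPE('d) \<kappa>"
  proof
    assume "E \<in> mourre_set TYPE('d) \<kappa>"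
    then obtain \<rho> and B :: "'d ell2 \<Rightarrow> 'd ell2" and a b P \<gamma> where
      adj: "self_adjoint_comb TYPE('d) \<rho> \<kappa>" "commutator_ext \<rho> \<kappa> B" "a < E" "E < b"
        "spectral_projection mv_laplacian {a<..<b} P" and \<gamma>: "\<gamma> > 0"
        and est: "\<And>u. inner u (P (B (P u))) \<ge> \<gamma> * inner u (P u)"
      unfolding mourre_set_def by blast
    define G where "G y = (\<Sum>k. \<rho> (Suc k) * g_fun (Suc k * \<kappa>) y)" for y :: "real ^ 'd"
    note estimate = mourre_estimate_on_energy_surface[OF \<kappa> adj est]
    have "G (x m) = (\<Sum>k. \<Sum>q<m. \<omega> q * (\<rho> (Suc k) * g_fun (Suc k * \<kappa>) (x q)))"
      unfolding G_def by (subst comb) (simp_all add: sum_distrib_left mult_ac)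
    also have "\<dots> = (\<Sum>q<m. \<Sum>k. \<omega> q * (\<rho> (Suc k) * g_fun (Suc k * \<kappa>) (x q)))"
      by (intro suminf_sum summable_mult estimate(1) x) auto
    also have "\<dots> = (\<Sum>q<m. \<omega> q * G (x q))"
      unfolding G_def by (intro sum.cong refl suminf_mult estimate(1) x) auto
    also have "\<dots> \<le> 0"
    proof (intro sum_nonpos mult_nonpos_nonneg)
      fix q assume "q \<in> {..<m}"
      then show "\<omega> q \<le> 0" "0 \<le> G (x q)"
        using \<omega> estimate(2)[OF x, of q] \<gamma> by (auto simp: G_def)
    qed
    finally show False using estimate(2)[OF x, of m] \<gamma> by (simp add: G_def)
  qed
  moreover have "complex_of_real E \<in> spectrum (mv_laplacian :: 'd ell2 \<Rightarrow> 'd ell2)"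
    using energy_in_spectrum[OF x[of m]] by simp
  ultimately show "E \<in> threshold_set TYPE('d) \<kappa>" by (simp add: threshold_set_def)
qed

section \<open>The reflection at an extremum of the Chebyshev polynomial\<close>

locale energy_window =
  fixes \<kappa> j :: nat
  assumes even_kappa: "even \<kappa>" and odd_j: "odd j" and j_less: "2 * j < \<kappa>"
begin

text \<open>In terms of \<open>c\<^sub>i = cos (i \<pi> / \<kappa>)\<close> the numbers \<open>low\<close>, \<open>mid\<close> and \<open>upper\<close> are \<open>c\<^sub>j\<^sub>+\<^sub>1\<close>, \<open>c\<^sub>j\<close> and
\<open>c\<^sub>j\<^sub>-\<^sub>1\<close>: consecutive extrema of \<open>T\<^sub>\<kappa>\<close>, with \<open>mid\<close> a minimum because \<open>j\<close> is odd.\<close>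

definition "step = pi / real \<kappa>"
definition "mid_angle = real j * step"
definition "mid = cos mid_angle"
definition "upper = cos (mid_angle - step)"
definition "low = cos (mid_angle + step)"

definition reflect :: "real \<Rightarrow> real" where
  "reflect x = cos (2 * mid_angle - arccos x)"

lemma kappa_step: "real \<kappa> * step = pi" and step_pos: "0 < step"
  using j_less by (simp_all add: step_def)

text \<open>Both \<open>\<kappa>\<close> even and \<open>2 j < \<kappa>\<close> enter here: together they give \<open>2 (j + 1) \<le> \<kappa>\<close>, so that \<open>low\<close> is
nonnegative.\<close>

lemma angle_bounds: "step \<le> mid_angle" "mid_angle + step \<le> pi / 2"
proof -
  have "real j \<ge> 1" using odd_j by (cases j) auto
  then show "step \<le> mid_angle" using step_pos by (simp add: mid_angle_def)
  obtain k where k: "\<kappa> = 2 * k" using even_kappa by blast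
  then have "j + 1 \<le> k" using j_less by simp
  then have "real j + 1 \<le> real k" by linarith
  then have "(real j + 1) * step \<le> real k * step" using step_pos by (intro mult_right_mono) auto
  also have "\<dots> = pi / 2" using kappa_step k by simp
  finally show "mid_angle + step \<le> pi / 2" by (simp add: mid_angle_def algebra_simps)
qed

lemma window_bounds: "0 \<le> low" "low < mid" "mid < upper" "upper \<le> 1" "0 < mid"
proof -
  note b = angle_bounds step_pos
  show "0 \<le> low" unfolding low_def using b by (intro cos_ge_zero) auto
  show "low < mid" unfolding low_def mid_def using b pi_gt_zero by (intro cos_monotone_0_pi) linarith+
  show "mid < upper" unfolding upper_def mid_def using b pi_gt_zero by (intro cos_monotone_0_pi) linarith+
  show "upper \<le> 1" by (simp add: upper_def)
  show "0 < mid" unfolding mid_def using b by (intro cos_gt_zero_pi) auto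
qed

text \<open>In fact \<open>cos (a + h) cos (a - h) = (cos a)\<^sup>2 - (sin h)\<^sup>2\<close>. The inequality guarantees that the chain
never leaves the interval on which the reflection is antitone.\<close>

lemma low_upper: "low * upper < mid\<^sup>2"
proof -
  have "low * upper = mid\<^sup>2 - (sin step)\<^sup>2"
  proof -
    have "low * upper = (cos mid_angle)\<^sup>2 * (cos step)\<^sup>2 - (sin mid_angle)\<^sup>2 * (sin step)\<^sup>2"
      by (simp add: low_def upper_def cos_add cos_diff power2_eq_square algebra_simps)
    also have "\<dots> = (cos mid_angle)\<^sup>2 - (sin step)\<^sup>2"
      by (simp add: sin_squared_eq algebra_simps)
    finally show ?thesis by (simp add: mid_def)
  qed
  moreover have "sin step > 0"
    using angle_bounds step_pos pi_gt_zero by (intro sin_gt_zero) linarith+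
  ultimately show ?thesis by simp
qed

lemma arccos_window:
  assumes "low \<le> x" "x \<le> mid"
  shows "mid_angle \<le> arccos x" "arccos x \<le> mid_angle + step"
proof -
  note b = angle_bounds step_pos pi_gt_zero
  have x: "-1 \<le> x" "x \<le> 1" using assms window_bounds by linarith+
  have "arccos (cos mid_angle) \<le> arccos x"
    using assms x by (intro arccos_le_arccos) (auto simp: mid_def)
  then show "mid_angle \<le> arccos x" using b by (simp add: arccos_cos)
  have "arccos x \<le> arccos (cos (mid_angle + step))"
    using assms x by (intro arccos_le_arccos) (auto simp: low_def)
  also have "\<dots> = mid_angle + step" using b by (intro arccos_cos) linarith+
  finally show "arccos x \<le> mid_angle + step" .
qed

lemma arccos_reflect:
  assumes "low \<le> x" "x \<le> mid"
  shows "arccos (reflect x) = 2 * mid_angle - arccos x"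
  unfolding reflect_def
  using arccos_window[OF assms] angle_bounds step_pos pi_gt_zero by (intro arccos_cos) linarith+

lemma reflect_less:
  assumes "low \<le> x" "x < y" "y \<le> mid"
  shows "reflect y < reflect x"
proof -
  have "arccos y < arccos x"
    using assms window_bounds by (intro arccos_less_arccos) auto
  then show ?thesis
    unfolding reflect_def
    using arccos_window[of x] arccos_window[of y] assms angle_bounds pi_gt_zero
    by (intro cos_monotone_0_pi) linarith+
qed

lemma reflect_le: "low \<le> x \<Longrightarrow> x \<le> y \<Longrightarrow> y \<le> mid \<Longrightarrow> reflect y \<le> reflect x"
  using reflect_less[of x y] by (cases "x = y") auto

lemma reflect_mid: "reflect mid = mid"
proof -
  have "arccos mid = mid_angle"
    unfolding mid_def using angle_bounds step_pos pi_gt_zero by (intro arccos_cos) linarith+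
  then show ?thesis by (simp add: reflect_def mid_def)
qed

lemma reflect_low: "reflect low = upper"
proof -
  have "arccos low = mid_angle + step"
    unfolding low_def using angle_bounds step_pos pi_gt_zero by (intro arccos_cos) linarith+
  then show ?thesis by (simp add: reflect_def upper_def algebra_simps)
qed

lemma kappa_mid_angle: "real \<kappa> * mid_angle = real j * pi"
  using kappa_step by (simp add: mid_angle_def algebra_simps)

lemma sin_reflect:
  assumes "low \<le> x" "x \<le> mid"
  shows "sin (real (p * \<kappa>) * arccos (reflect x)) = - sin (real (p * \<kappa>) * arccos x)"
proof -
  have "real (p * \<kappa>) * arccos (reflect x) = real (2 * p * j) * pi - real (p * \<kappa>) * arccos x"
    unfolding arccos_reflect[OF assms]
    using kappa_mid_angle by (simp add: algebra_simps)
  then show ?thesis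
    using sin_npi[of "2 * p * j"] cos_npi[of "2 * p * j"] by (simp only: sin_diff) simp
qed

lemma cheb_T_reflect:
  assumes "low \<le> x" "x \<le> mid"
  shows "cheb_T \<kappa> (reflect x) = cheb_T \<kappa> x"
proof -
  have x: "cos (arccos x) = x" using assms window_bounds by (intro cos_arccos) auto
  have "real \<kappa> * (2 * mid_angle - arccos x) = real (2 * j) * pi - real \<kappa> * arccos x"
    using kappa_mid_angle by (simp add: algebra_simps)
  then have "cheb_T \<kappa> (reflect x) = cos (real (2 * j) * pi - real \<kappa> * arccos x)"
    unfolding reflect_def cheb_T_cos by simp
  also have "\<dots> = cos (real \<kappa> * arccos x)"
    using sin_npi[of "2 * j"] cos_npi[of "2 * j"] by (simp only: cos_diff) simp
  also have "\<dots> = cheb_T \<kappa> x" by (metis cheb_T_cos x)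
  finally show ?thesis .
qed

lemma continuous_on_reflect: "continuous_on {low..mid} reflect"
  unfolding reflect_def[abs_def] using window_bounds
  by (intro continuous_intros) auto

section \<open>Chains of reflected ratios\<close>

text \<open>The minimum with \<open>mid\<close> keeps the recursion defined, continuous and antitone for every \<open>E\<close> in the
closed window. It is inactive at the energies that are selected below
(\<open>energy_ratio_less\<close>).\<close>

fun chain :: "real \<Rightarrow> nat \<Rightarrow> real" where
  "chain E 0 = upper"
| "chain E (Suc k) = reflect (min (E / chain E k) mid)"

lemmas chain_Suc = chain.simps(2)
declare chain_Suc [simp del]

definition "window = {mid\<^sup>2 .. upper * mid}"

lemma mid_sq_less: "mid\<^sup>2 < upper * mid"
  using window_bounds by (simp add: power2_eq_square)

lemma window_pos: "E \<in> window \<Longrightarrow> 0 < E"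
proof -
  have "0 < mid\<^sup>2" using window_bounds by simp
  then show "E \<in> window \<Longrightarrow> 0 < E" unfolding window_def atLeastAtMost_iff by linarith
qed

lemma ratio_gt_low:
  assumes "E \<in> window" "0 < y" "y \<le> upper"
  shows "low < E / y"
proof -
  have "low * y \<le> low * upper" using assms window_bounds by (intro mult_left_mono) auto
  also have "\<dots> < mid\<^sup>2" by (rule low_upper)
  also have "\<dots> \<le> E" using assms by (simp add: window_def)
  finally show ?thesis using assms by (simp add: field_simps)
qed

lemma chain_bounds:
  assumes "E \<in> window"
  shows "mid \<le> chain E k \<and> chain E k \<le> upper"
proof (induction k)
  case (Suc k)
  then have "low < E / chain E k"
    using assms window_bounds by (intro ratio_gt_low) auto
  then have "low \<le> min (E / chain E k) mid" "min (E / chain E k) mid \<le> mid"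
    using window_bounds by auto
  then show ?case
    using reflect_le[of "min (E / chain E k) mid" mid] reflect_le[of low "min (E / chain E k) mid"] window_bounds
    by (simp add: chain_Suc reflect_mid reflect_low)
qed (use window_bounds in auto)

lemma chain_pos: "E \<in> window \<Longrightarrow> 0 < chain E k"
  using chain_bounds[of E k] window_bounds by linarith

lemma chain_ratio: "E \<in> window \<Longrightarrow> low < E / chain E k"
  using chain_bounds[of E k] chain_pos[of E k] ratio_gt_low by blast

lemma chain_antimono:
  assumes "E \<in> window" "E' \<in> window" "E \<le> E'"
  shows "chain E' k \<le> chain E k"
proof (induction k)
  case (Suc k)
  have "E / chain E k \<le> E' / chain E' k"
    using assms Suc chain_pos[OF assms(2), of k] window_bounds
    by (intro frac_le) (use window_pos[OF assms(1)] window_pos[OF assms(2)] in auto)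
  then show ?case
    using chain_ratio[OF assms(1), of k] window_bounds by (auto simp: chain_Suc intro!: reflect_le)
qed auto

lemma continuous_on_chain: "continuous_on window (\<lambda>E. chain E k)"
proof (induction k)
  case (Suc k)
  show ?case
    unfolding chain_Suc
  proof (rule continuous_on_compose2[OF continuous_on_reflect])
    show "continuous_on window (\<lambda>E. min (E / chain E k) mid)"
    proof (intro continuous_intros Suc ballI)
      show "chain E k \<noteq> 0" if "E \<in> window" for E using chain_pos[OF that, of k] by simp
    qed
    show "(\<lambda>E. min (E / chain E k) mid) ` window \<subseteq> {low..mid}"
      using chain_ratio[of _ k] window_bounds by (fastforce simp: less_imp_le)
  qed
qed auto

lemma chain_unclipped:
  assumes "E \<in> window" "mid < chain E (Suc k)"
  shows "E / chain E k < mid"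
proof (rule ccontr)
  assume "\<not> ?thesis"
  then have "min (E / chain E k) mid = mid" by simp
  then show False using assms(2) by (simp add: chain_Suc reflect_mid)
qed

text \<open>Once the chain reaches \<open>mid\<close> it stays there. Above \<open>mid\<close> the step before was not truncated, and
strict monotonicity propagates through the two antitone maps \<open>y \<mapsto> E / y\<close> and \<open>reflect\<close>.\<close>

lemma chain_decreasing:
  assumes E: "E \<in> window"
  shows "chain E (Suc k) \<le> chain E k \<and> (mid < chain E k \<longrightarrow> chain E (Suc k) < chain E k)"
proof (induction k)
  case 0
  have "low < min (E / upper) mid" using chain_ratio[OF E, of 0] window_bounds by simp
  then have "reflect (min (E / upper) mid) < reflect low" by (intro reflect_less) auto
  then show ?case by (simp add: chain_Suc reflect_low)
next
  case (Suc k)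
  show ?case
  proof (cases "mid < chain E (Suc k)")
    case True
    then have less: "chain E (Suc k) < chain E k" using Suc by auto
    have unclipped: "E / chain E k < mid" by (rule chain_unclipped[OF E True])
    have "E > 0" using E by (rule window_pos)
    then have "E / chain E k < E / chain E (Suc k)"
      using less chain_pos[OF E] by (intro divide_strict_left_mono mult_pos_pos) auto
    then have "reflect (min (E / chain E (Suc k)) mid) < reflect (min (E / chain E k) mid)"
      using unclipped chain_ratio[OF E, of k] by (intro reflect_less) auto
    then show ?thesis by (simp add: chain_Suc)
  next
    case False
    then have eq: "chain E (Suc k) = mid" using chain_bounds[OF E, of "Suc k"] by linarith
    have "mid \<le> E / mid" using E window_bounds by (simp add: window_def field_simps power2_eq_square)
    then have "chain E (Suc (Suc k)) = mid"
      unfolding chain_Suc[of E "Suc k"] eq by (simp add: reflect_mid)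
    then show ?thesis using eq by simp
  qed
qed

lemma chain_mono_index: "E \<in> window \<Longrightarrow> k \<le> m \<Longrightarrow> chain E m \<le> chain E k"
  by (rule lift_Suc_antimono_le[of "chain E"]) (use chain_decreasing in auto)

lemma chain_left_end: "mid < chain (mid\<^sup>2) k"
proof (induction k)
  case (Suc k)
  have w: "mid\<^sup>2 \<in> window" using mid_sq_less by (simp add: window_def)
  have "mid\<^sup>2 / chain (mid\<^sup>2) k < mid"
    using Suc window_bounds chain_pos[OF w, of k] by (simp add: field_simps power2_eq_square)
  then show ?case
    using reflect_less[of "mid\<^sup>2 / chain (mid\<^sup>2) k" mid] chain_ratio[OF w, of k]
    by (simp add: chain_Suc reflect_mid)
qed (use window_bounds in auto)

lemma chain_right_end: "chain (upper * mid) (Suc k) = mid"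
proof -
  have w: "upper * mid \<in> window" using mid_sq_less by (simp add: window_def)
  have "mid \<le> upper * mid / chain (upper * mid) k"
    using chain_bounds[OF w, of k] chain_pos[OF w, of k] window_bounds by (simp add: field_simps)
  then show ?thesis by (simp add: chain_Suc reflect_mid)
qed

section \<open>Energies at which the chain closes\<close>

text \<open>The number \<open>m\<close> of steps after which the chain for \<open>\<E>\<^sub>n\<close> closes: \<open>n = 2 m - 1\<close> or \<open>n = 2 m\<close>.\<close>

definition half :: "nat \<Rightarrow> nat" where
  "half n = (n + 1) div 2"

text \<open>Vanishes if and only if the chain closes: \<open>y\<^sub>m\<^sup>2 = E\<close> for odd \<open>n\<close> and \<open>mid y\<^sub>m = E\<close> for even \<open>n\<close>.\<close>

definition residual :: "nat \<Rightarrow> real \<Rightarrow> real" where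
  "residual n E = (if odd n then chain E (half n) else mid) * chain E (half n) - E"

definition energy :: "nat \<Rightarrow> real" where
  "energy n = (SOME E. mid\<^sup>2 < E \<and> E < upper * mid \<and> residual n E = 0)"

lemma residual_antimono:
  assumes "E \<in> window" "E' \<in> window" "E \<le> E'"
  shows "residual n E' \<le> residual n E"
proof -
  have c: "0 \<le> chain E' (half n)" "chain E' (half n) \<le> chain E (half n)"
    using chain_pos[OF assms(2), of "half n"] chain_antimono[OF assms, of "half n"] by auto
  then have "(if odd n then chain E' (half n) else mid) * chain E' (half n)
      \<le> (if odd n then chain E (half n) else mid) * chain E (half n)"
    using window_bounds by (auto intro!: mult_mono)
  then show ?thesis using assms by (simp add: residual_def)
qed

text \<open>At the left end of the window every \<open>y\<^sub>k\<close> exceeds \<open>mid\<close>, at the right end all \<open>y\<^sub>k\<close> with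
\<open>k \<ge> 1\<close> equal \<open>mid\<close>; so the residual changes sign strictly inside.\<close>

lemma energy_root:
  assumes "n \<ge> 1"
  shows "mid\<^sup>2 < energy n \<and> energy n < upper * mid \<and> residual n (energy n) = 0"
proof -
  obtain k where k: "half n = Suc k"
    using assms by (cases "half n") (auto simp: half_def)
  have left: "0 < residual n (mid\<^sup>2)"
  proof -
    have "mid * mid < (if odd n then chain (mid\<^sup>2) (half n) else mid) * chain (mid\<^sup>2) (half n)"
      using chain_left_end[of "half n"] window_bounds by (auto intro!: mult_strict_mono)
    then show ?thesis unfolding residual_def power2_eq_square by simp
  qed
  have right: "residual n (upper * mid) < 0"
    using mid_sq_less by (simp add: residual_def k chain_right_end power2_eq_square)
  have "continuous_on {mid\<^sup>2..upper * mid} (residual n)"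
    unfolding residual_def[abs_def]
    using continuous_on_chain[of "half n"] unfolding window_def
    by (cases "odd n") (auto intro!: continuous_intros)
  then obtain E where E: "mid\<^sup>2 \<le> E" "E \<le> upper * mid" "residual n E = 0"
    using IVT2'[of "residual n" "upper * mid" 0 "mid\<^sup>2"] left right mid_sq_less by auto
  then have "mid\<^sup>2 < E \<and> E < upper * mid \<and> residual n E = 0"
    using left right by (metis less_irrefl order_le_less)
  then show ?thesis unfolding energy_def by (rule someI)
qed

context
  fixes n :: nat
  assumes n: "n \<ge> 1"
begin

lemma half_pos: "half n \<ge> 1" using n by (simp add: half_def)

lemma half_cases: "odd n \<Longrightarrow> n + 1 = 2 * half n" "even n \<Longrightarrow> n = 2 * half n"
  by (auto simp: half_def elim!: oddE evenE)

lemma energy_window: "energy n \<in> window"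
  using energy_root[OF n] by (simp add: window_def)

lemma energy_pos: "0 < energy n"
  by (rule window_pos[OF energy_window])

lemma energy_odd: "odd n \<Longrightarrow> energy n / chain (energy n) (half n) = chain (energy n) (half n)"
  using energy_root[OF n] chain_pos[OF energy_window, of "half n"] by (simp add: residual_def field_simps)

lemma energy_even: "even n \<Longrightarrow> energy n / chain (energy n) (half n) = mid"
  using energy_root[OF n] chain_pos[OF energy_window, of "half n"] by (simp add: residual_def field_simps)

text \<open>Otherwise the closing condition would read \<open>mid\<^sup>2 = E\<close>, the excluded left end of the window.\<close>

lemma energy_chain_last: "mid < chain (energy n) (half n)"
proof (rule ccontr)
  assume "\<not> ?thesis"
  then have "chain (energy n) (half n) = mid"
    using chain_bounds[OF energy_window, of "half n"] by linarith
  then have "residual n (energy n) = mid\<^sup>2 - energy n" by (simp add: residual_def power2_eq_square)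
  then show False using energy_root[OF n] by simp
qed

lemma energy_chain_gt: "k \<le> half n \<Longrightarrow> mid < chain (energy n) k"
  using energy_chain_last chain_mono_index[OF energy_window, of k "half n"] by linarith

lemma energy_chain_less: "k \<le> half n \<Longrightarrow> chain (energy n) (Suc k) < chain (energy n) k"
  using energy_chain_gt chain_decreasing[OF energy_window] by blast

lemma energy_ratio_less: "k < half n \<Longrightarrow> energy n / chain (energy n) k < mid"
  by (rule chain_unclipped[OF energy_window energy_chain_gt]) simp

lemma energy_chain_Suc:
  "k < half n \<Longrightarrow> chain (energy n) (Suc k) = reflect (energy n / chain (energy n) k)"
  using energy_ratio_less[of k] by (simp add: chain_Suc min_def)

lemma energy_ratio_low: "low \<le> energy n / chain (energy n) k"
  using chain_ratio[OF energy_window, of k] by simp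

text \<open>The next residual is negative at the present energy and antitone, so its root lies to the left.
From odd to even \<open>n\<close> this is \<open>mid y\<^sub>m < y\<^sub>m\<^sup>2 = E\<close>; from even to odd it is \<open>y\<^sub>m\<^sub>+\<^sub>1 = mid\<close> and
\<open>mid\<^sup>2 < E\<close>.\<close>

lemma energy_Suc_less: "energy (Suc n) < energy n"
proof (rule ccontr)
  assume "\<not> ?thesis"
  moreover have "energy (Suc n) \<in> window"
    using energy_root[of "Suc n"] by (simp add: window_def)
  ultimately have "residual (Suc n) (energy (Suc n)) \<le> residual (Suc n) (energy n)"
    by (intro residual_antimono energy_window) auto
  then have ge: "0 \<le> residual (Suc n) (energy n)" using energy_root[of "Suc n"] by simp
  show False
  proof (cases "odd n")
    case True
    then have "half (Suc n) = half n" by (auto simp: half_def elim!: oddE)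
    moreover have "mid * chain (energy n) (half n) < chain (energy n) (half n) * chain (energy n) (half n)"
      using energy_chain_last window_bounds by (intro mult_strict_right_mono) auto
    moreover have "chain (energy n) (half n) * chain (energy n) (half n) = energy n"
      using True energy_root[OF n] by (simp add: residual_def)
    ultimately show False using ge True by (simp add: residual_def)
  next
    case False
    then have "half (Suc n) = Suc (half n)" by (auto simp: half_def elim!: evenE)
    moreover have "chain (energy n) (Suc (half n)) = mid"
      using energy_even False by (simp add: chain_Suc reflect_mid)
    ultimately have "residual (Suc n) (energy n) = mid\<^sup>2 - energy n"
      using False by (simp add: residual_def power2_eq_square)
    then show False using ge energy_root[OF n] by simp
  qed
qed

definition "points i = (if i \<le> half n then energy n / chain (energy n) i else chain (energy n) (n + 1 - i))"

text \<open>For odd \<open>n\<close> and \<open>r = half n\<close> the point is defined by the lower branch, and the two branches agree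
by the closing condition.\<close>

lemma points_upper: "r \<le> half n \<Longrightarrow> points (n + 1 - r) = chain (energy n) r"
proof -
  assume r: "r \<le> half n"
  show ?thesis
  proof (cases "n + 1 - r \<le> half n")
    case True
    then have "odd n" "n + 1 - r = half n" "r = half n"
      using r half_cases by (cases "odd n"; force)+
    then show ?thesis using energy_odd by (simp add: points_def)
  next
    case False
    moreover have "n + 1 - (n + 1 - r) = r" using r by (simp add: half_def)
    ultimately show ?thesis by (simp add: points_def)
  qed
qed

lemma points_lower: "r \<le> half n \<Longrightarrow> points r = energy n / chain (energy n) r"
  by (simp add: points_def)

lemma points_increasing:
  assumes "i \<le> n"
  shows "points i < points (i + 1)"
proof -
  consider "i < half n" | "i = half n" | "half n < i" by linarith
  then show ?thesis
  proof cases
    case 1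
    have "energy n / chain (energy n) i < energy n / chain (energy n) (Suc i)"
      using energy_chain_less[of i] 1 energy_pos chain_pos[OF energy_window]
      by (intro divide_strict_left_mono mult_pos_pos) auto
    then show ?thesis using 1 by (simp add: points_def)
  next
    case 2
    show ?thesis
    proof (cases "odd n")
      case True
      then have i: "n - i = half n - 1" "half n = Suc (half n - 1)"
        using 2 half_cases half_pos by auto
      have "chain (energy n) (half n) < chain (energy n) (half n - 1)"
        using energy_chain_less[of "half n - 1"] i(2) by simp
      then show ?thesis using 2 i energy_odd[OF True] by (simp add: points_def)
    next
      case False
      then have "n - i = half n" using 2 half_cases by auto
      then show ?thesis
        using 2 energy_even False energy_chain_last by (simp add: points_def)
    qed
  next
    case 3
    have e: "n + 1 - i = Suc (n - i)" using assms by simp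
    have "n - i \<le> half n" using 3 by (simp add: half_def)
    then have "chain (energy n) (Suc (n - i)) < chain (energy n) (n - i)" by (rule energy_chain_less)
    then show ?thesis using 3 e by (simp add: points_def)
  qed
qed

lemma points_Sigma_system: "Sigma_system \<kappa> n (energy n) points"
proof -
  have refl: "cheb_T \<kappa> (points q) = cheb_T \<kappa> (points (n - q))" if "q < half n" for q
  proof -
    have "n - q = n + 1 - Suc q" using that by (simp add: half_def)
    then have "points (n - q) = reflect (points q)"
      using points_upper[of "Suc q"] energy_chain_Suc[of q] that by (simp add: points_lower)
    moreover have "low \<le> points q" "points q \<le> mid"
      using that energy_ratio_low energy_ratio_less[of q] by (simp_all add: points_lower)
    ultimately show ?thesis by (simp add: cheb_T_reflect)
  qed
  have recip: "points (n + 1 - r) = energy n / points r" if "r \<le> half n" for r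
    using that points_upper points_lower energy_pos chain_pos[OF energy_window, of r] by simp
  show ?thesis
  proof (cases "odd n")
    case True
    then have "(n - 1) div 2 < half n" "(n + 1) div 2 \<le> half n" by (auto simp: half_def elim!: oddE)
    then show ?thesis using True refl recip by (simp add: Sigma_system_def)
  next
    case False
    then have "n div 2 \<le> half n" by (auto simp: half_def)
    then show ?thesis using False refl recip by (simp add: Sigma_system_def)
  qed
qed

end

end

section \<open>Cone relations along a closed chain\<close>

text \<open>Forward substitution: \<open>F\<^sub>q = (G\<^sub>q + b\<^sub>q F\<^sub>q\<^sub>-\<^sub>1) / a\<^sub>q\<close> has only nonnegative coefficients. The
weights do not depend on \<open>p\<close>, as the same ones must serve all \<open>g\<^sub>p\<^sub>\<kappa>\<close> simultaneously.\<close>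

lemma bidiagonal_cone:
  fixes F G :: "'p \<Rightarrow> nat \<Rightarrow> real"
  assumes "\<And>q. q \<le> k \<Longrightarrow> 0 < a q" "\<And>q. q \<le> k \<Longrightarrow> 0 \<le> b q"
    and "\<And>p. p \<in> S \<Longrightarrow> G p 0 = a 0 * F p 0"
    and "\<And>p q. p \<in> S \<Longrightarrow> Suc q \<le> k \<Longrightarrow> G p (Suc q) = a (Suc q) * F p (Suc q) - b (Suc q) * F p q"
  shows "\<exists>w. (\<forall>q\<le>k. 0 \<le> w q) \<and> (\<forall>p\<in>S. F p k = (\<Sum>q\<le>k. w q * G p q))"
  using assms
proof (induction k)
  case 0
  then show ?case by (intro exI[of _ "\<lambda>_. 1 / a 0"]) (simp add: less_imp_le less_imp_neq[symmetric])
next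
  case (Suc k)
  have "\<exists>w. (\<forall>q\<le>k. 0 \<le> w q) \<and> (\<forall>p\<in>S. F p k = (\<Sum>q\<le>k. w q * G p q))"
    by (rule Suc.IH) (use Suc.prems in auto)
  then obtain w where w: "\<And>q. q \<le> k \<Longrightarrow> 0 \<le> w q"
      "\<And>p. p \<in> S \<Longrightarrow> F p k = (\<Sum>q\<le>k. w q * G p q)"
    by blast
  define c where "c = b (Suc k) / a (Suc k)"
  have a: "a (Suc k) > 0" and c: "c \<ge> 0" using Suc.prems(1,2)[of "Suc k"] by (simp_all add: c_def)
  define w' where "w' q = (if q = Suc k then 1 / a (Suc k) else c * w q)" for q
  have "F p (Suc k) = (\<Sum>q\<le>Suc k. w' q * G p q)" if p: "p \<in> S" for p
  proof -
    have "(\<Sum>q\<le>Suc k. w' q * G p q) = c * F p k + G p (Suc k) / a (Suc k)"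
      by (simp add: w'_def w(2)[OF p] sum_distrib_left mult.assoc)
    also have "\<dots> = F p (Suc k)"
      using a Suc.prems(4)[OF p, of k] by (simp add: c_def field_simps)
    finally show ?thesis ..
  qed
  moreover have "0 \<le> w' q" if "q \<le> Suc k" for q
    using w(1)[of q] a c that by (auto simp: w'_def le_Suc_eq)
  ultimately show ?case by blast
qed

lemma g_fun_2:
  fixes x y :: real
  assumes "k \<ge> 1" "x \<in> {-1..1}" "y \<in> {-1..1}"
  shows "g_fun k (vector [x, y] :: real ^ 2) =
    y * sin (arccos x) * sin (real k * arccos x) + x * sin (arccos y) * sin (real k * arccos y)"
proof -
  have U: "(1 - z\<^sup>2) * cheb_U (k - 1) z = sin (arccos z) * sin (real k * arccos z)" if "z \<in> {-1..1}" for z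
    using cheb_U_mult_sin_squared[OF assms(1), of "arccos z"] that by simp
  have "UNIV - {1} = {2 :: 2}" "UNIV - {2} = {1 :: 2}" by (auto simp: UNIV_2)
  then have "g_fun k (vector [x, y] :: real ^ 2)
      = y * ((1 - x\<^sup>2) * cheb_U (k - 1) x) + x * ((1 - y\<^sup>2) * cheb_U (k - 1) y)"
    by (simp add: g_fun_def sum_2 mult.assoc)
  then show ?thesis unfolding U[OF assms(2)] U[OF assms(3)] by simp
qed

context energy_window begin

text \<open>The points are \<open>z q = (E / y q, y q)\<close>. Since \<open>y (q + 1)\<close> is the reflection of \<open>E / y q\<close>, the
second summand of \<open>g\<close> at \<open>z (q + 1)\<close> is a nonpositive multiple of the quantity \<open>F p q\<close> that occurs
in the first summand at \<open>z q\<close>; at \<open>z 0\<close> the second summand vanishes because \<open>\<kappa>\<close> times the angle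
of \<open>upper\<close> is a multiple of \<open>\<pi>\<close>.\<close>

lemma energy_in_threshold_set_m:
  assumes n: "n \<ge> 1"
  shows "energy n \<in> threshold_set_m TYPE(2) (half n) \<kappa>"
proof -
  note window = energy_window[OF n]
  define m where "m = half n"
  define E where "E = energy n"
  define y where "y q = chain E q" for q
  define x where "x q = E / y q" for q
  define z where "z q = (vector [x q, y q] :: real ^ 2)" for q
  define F where "F p q = sin (real (p * \<kappa>) * arccos (x q))" for p q
  define a where "a q = y q * sin (arccos (x q))" for q
  define b where "b q = x q * sin (arccos (y q))" for q

  have m: "m \<ge> 1" using half_pos[OF n] by (simp add: m_def)
  have y: "0 < y q" "y q \<le> 1" for q
    using chain_pos[OF window, of q] chain_bounds[OF window, of q] window_bounds by (auto simp: y_def E_def)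
  have x: "low \<le> x q" "0 < x q" for q
    using energy_ratio_low[OF n, of q] energy_pos[OF n] y(1)[of q] by (simp_all add: x_def y_def E_def)
  have x_mid: "x q < mid" if "q < m" for q
    using energy_ratio_less[OF n, of q] that by (simp add: x_def y_def E_def m_def)
  have x_1: "x q \<le> 1" if "q \<le> m" for q
  proof (cases "q = m")
    case True
    have "x m = y m \<or> x m = mid"
      using energy_odd[OF n] energy_even[OF n] by (auto simp: x_def y_def E_def m_def)
    then show ?thesis using y(2)[of m] window_bounds True by auto
  qed (use x_mid[of q] window_bounds that in auto)
  have G: "g_fun (p * \<kappa>) (z q) = a q * F p q + b q * sin (real (p * \<kappa>) * arccos (y q))"
    if "p \<ge> 1" "q \<le> m" for p q
  proof -
    have "p * \<kappa> \<ge> 1" using that j_less by (cases \<kappa>) auto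
    then show ?thesis
      unfolding z_def F_def a_def b_def
      using x(2)[of q] x_1[OF that(2)] y[of q] by (intro g_fun_2) auto
  qed
  have b: "0 \<le> b q" for q
    unfolding b_def using x(2)[of q] y[of q] by (intro mult_nonneg_nonneg sin_ge_zero arccos_lbound arccos_ubound) auto
  have a: "0 < a q" if "q < m" for q
    unfolding a_def
    using x(2)[of q] y(1)[of q] x_mid[OF that] window_bounds by (intro mult_pos_pos) (auto simp: sin_arccos abs_square_less_1)
  have upper: "sin (real (p * \<kappa>) * arccos (y 0)) = 0" for p
  proof -
    have "arccos upper = mid_angle - step"
      unfolding upper_def using angle_bounds step_pos pi_gt_zero by (intro arccos_cos) linarith+
    then have "real (p * \<kappa>) * arccos (y 0) = real p * (real \<kappa> * mid_angle - real \<kappa> * step)"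
      by (simp add: y_def right_diff_distrib mult.assoc)
    also have "\<dots> = real (p * (j - 1)) * pi"
      unfolding kappa_mid_angle kappa_step using odd_j
      by (simp add: of_nat_diff odd_pos Suc_leI algebra_simps)
    finally have "real (p * \<kappa>) * arccos (y 0) = real (p * (j - 1)) * pi" .
    then show ?thesis by (simp only: sin_npi)
  qed
  have reflected: "sin (real (p * \<kappa>) * arccos (y (Suc q))) = - F p q" if "q < m" for p q
  proof -
    have "y (Suc q) = reflect (x q)"
      using energy_chain_Suc[OF n, of q] that by (simp add: x_def y_def E_def m_def)
    then show ?thesis
      unfolding F_def using sin_reflect[of "x q" p] x(1)[of q] x_mid[OF that] by simp
  qed

  have G_0: "g_fun (p * \<kappa>) (z 0) = a 0 * F p 0" if "p \<ge> 1" for p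
    using G[OF that, of 0] upper by simp
  have G_Suc: "g_fun (p * \<kappa>) (z (Suc q)) = a (Suc q) * F p (Suc q) - b (Suc q) * F p q"
    if "p \<ge> 1" "q < m" for p q
    using G[OF that(1), of "Suc q"] reflected[OF that(2)] that by simp
  obtain k where k: "m = Suc k" using m by (cases m) auto
  have "\<exists>w. (\<forall>q\<le>k. 0 \<le> w q) \<and> (\<forall>p\<in>{1..}. F p k = (\<Sum>q\<le>k. w q * g_fun (p * \<kappa>) (z q)))"
    by (rule bidiagonal_cone[of k a b]) (use a b G_0 G_Suc k in auto)
  then obtain w where w: "\<And>q. q \<le> k \<Longrightarrow> 0 \<le> w q"
      "\<And>p. p \<ge> 1 \<Longrightarrow> F p k = (\<Sum>q\<le>k. w q * g_fun (p * \<kappa>) (z q))"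
    by fastforce

  \<comment> \<open>Closing: for odd \<open>n\<close> both coordinates of \<open>z m\<close> agree, so both summands are multiples of
    \<open>- F p k\<close>; for even \<open>n\<close> the first coordinate is \<open>mid\<close>, where \<open>F\<close> vanishes.\<close>
  have "\<exists>c\<ge>0. \<forall>p\<ge>1. g_fun (p * \<kappa>) (z m) = - c * F p k"
  proof (cases "odd n")
    case True
    have "x m = y m" using energy_odd[OF n True] by (simp add: x_def y_def E_def m_def)
    then have "a m = b m" "\<And>p. F p m = - F p k"
      using reflected[of k] k by (simp_all add: a_def b_def F_def)
    then show ?thesis
      using G_Suc[of _ k] b[of m] k by (intro exI[of _ "2 * b m"]) (auto simp: algebra_simps)
  next
    case False
    have "x m = mid" using energy_even[OF n] False by (simp add: x_def y_def E_def m_def)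
    moreover have "arccos mid = mid_angle"
      unfolding mid_def using angle_bounds step_pos pi_gt_zero by (intro arccos_cos) linarith+
    ultimately have "F p m = 0" for p
      using sin_npi[of "p * j"] kappa_mid_angle by (simp add: F_def mult.assoc)
    then show ?thesis
      using G_Suc[of _ k] b[of m] k by (intro exI[of _ "b m"]) auto
  qed
  then obtain c where c: "c \<ge> 0" "\<And>p. p \<ge> 1 \<Longrightarrow> g_fun (p * \<kappa>) (z m) = - c * F p k" by blast

  have "g_fun (p * \<kappa>) (z m) = (\<Sum>q<m. - c * w q * g_fun (p * \<kappa>) (z q))" if "p \<ge> 1" for p
  proof -
    have "g_fun (p * \<kappa>) (z m) = (\<Sum>q\<le>k. - c * w q * g_fun (p * \<kappa>) (z q))"
      unfolding c(2)[OF that] w(2)[OF that] sum_distrib_left mult.assoc ..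
    then show ?thesis by (simp add: k lessThan_Suc_atMost)
  qed
  moreover have "\<forall>q<m. - c * w q \<le> 0" using c(1) w(1) k by (auto intro: mult_nonneg_nonneg)
  moreover have surface: "z q \<in> energy_surface E" if "q \<le> m" for q
    using x(2)[of q] y[of q] x_1[OF that]
    by (auto simp: z_def energy_surface_def forall_2 UNIV_2 x_def)
  moreover have "E \<in> {-1..1}"
  proof -
    have "E = x 0 * y 0" using y(1)[of 0] by (simp add: x_def)
    then have "0 \<le> E" "E \<le> 1"
      using x(2)[of 0] y[of 0] x_1[of 0] by (auto intro!: mult_le_one)
    then show ?thesis by simp
  qed
  ultimately show ?thesis
    unfolding threshold_set_m_def E_def[symmetric] m_def[symmetric]
    by (intro CollectI conjI exI[of _ z] exI[of _ "\<lambda>q. - c * w q"]) auto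
qed

end

section \<open>The decreasing sequence of thresholds\<close>

theorem theorem7p1:
  fixes \<kappa> j :: nat
  assumes "\<kappa> \<ge> 4" and "even \<kappa>"
    and "odd j" and "1 \<le> j" and "j \<le> \<kappa> div 2"
    and "2 * j \<noteq> \<kappa>"
  shows "\<exists>E :: nat \<Rightarrow> real.
    (\<forall>n\<ge>1. E n \<in> {(cos (real j * pi / real \<kappa>))\<^sup>2 <..<
                    cos ((real j - 1) * pi / real \<kappa>) * cos (real j * pi / real \<kappa>)}
                \<inter> threshold_set TYPE(2) \<kappa>) \<and>
    (\<forall>n\<ge>1. E (n + 2) < E (n + 1) \<and> E (n + 1) < E n) \<and>
    (\<forall>n\<ge>1. E (2 * n - 1) \<in> threshold_set_m TYPE(2) n \<kappa> \<and>
             E (2 * n) \<in> threshold_set_m TYPE(2) n \<kappa>) \<and>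
    (\<forall>n\<ge>1. \<exists>X :: nat \<Rightarrow> real. Sigma_system \<kappa> n (E n) X \<and>
       X 0 = E n / cos ((real j - 1) * pi / real \<kappa>) \<and>
       (\<forall>i\<le>n. X i < X (i + 1)) \<and>
       X (n + 1) = cos ((real j - 1) * pi / real \<kappa>))"
proof -
  interpret energy_window \<kappa> j
    using assms by unfold_locales auto
  have angles: "mid = cos (real j * pi / real \<kappa>)" "upper = cos ((real j - 1) * pi / real \<kappa>)"
    by (simp_all add: mid_def upper_def mid_angle_def step_def diff_divide_distrib left_diff_distrib)
  have threshold: "energy n \<in> threshold_set_m TYPE(2) (half n) \<kappa>"
      "energy n \<in> threshold_set TYPE(2) \<kappa>" if "n \<ge> 1" for n
    using energy_in_threshold_set_m[OF that] threshold_set_m_subset_threshold_set[of \<kappa> "half n"] assms(1)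
    by auto
  have half: "half (2 * n - 1) = n" "half (2 * n) = n" if "n \<ge> 1" for n
    using that by (simp_all add: half_def)
  show ?thesis
    unfolding angles[symmetric]
  proof (rule exI[of _ energy], intro conjI allI impI)
    fix n :: nat assume n: "n \<ge> 1"
    show "energy n \<in> {mid\<^sup>2<..<upper * mid} \<inter> threshold_set TYPE(2) \<kappa>"
      using energy_root[OF n] threshold(2)[OF n] by simp
    show "energy (n + 2) < energy (n + 1)" "energy (n + 1) < energy n"
      using energy_Suc_less[of n] energy_Suc_less[of "Suc n"] n by simp_all
    show "energy (2 * n - 1) \<in> threshold_set_m TYPE(2) n \<kappa>"
      using threshold(1)[of "2 * n - 1"] half(1)[OF n] n by simp
    show "energy (2 * n) \<in> threshold_set_m TYPE(2) n \<kappa>"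
      using threshold(1)[of "2 * n"] half(2)[OF n] n by simp
    have "points n 0 = energy n / upper" "points n (n + 1) = upper"
      using points_lower[OF n, of 0] points_upper[OF n, of 0] by simp_all
    then show "\<exists>X. Sigma_system \<kappa> n (energy n) X \<and> X 0 = energy n / upper \<and>
        (\<forall>i\<le>n. X i < X (i + 1)) \<and> X (n + 1) = upper"
      using points_Sigma_system[OF n] points_increasing[OF n] by (intro exI[of _ "points n"]) simp
  qed
qed

end
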